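(* If $G$ is a finite strongly chordal graph, then $G$ admits an MAT-labeling.
   Context: A graph is chordal if it has no induced cycle of length greater than three; it is strongly chordal if it is chordal and has no induced $n$-sun for any $n\ge3$, where the $n$-sun has vertices $u_1,\dots,u_n,w_1,\dots,w_n$ and edges $\{u_i,u_j\}$ ($1\le i<j\le n$), $\{w_i,u_i\},\{w_i,u_{i+1}\}$ (indices mod $n$). For a simple graph $G$ and $\lambda:E_G\to\mathbb{Z}_{>0}$ put $\pi_k=\lambda^{-1}(k)$, $E_k=\pi_1\sqcup\dots\sqcup\pi_k$, $E_0=\varnothing$; $\operatorname{cl}(F)$ is the set of edges whose endvertices are joined by a path of edges in $F$; $\lambda$ is an MAT-labeling if for all $k\ge1$: (ML1) $\pi_k$ is a forest; (ML2) $\operatorname{cl}(\pi_k)\cap E_{k-1}=\varnothing$; (ML3) each $\{u,u'\}\in\pi_k$ has exactly $k-1$ vertices $w$ with $\{u,w\},\{u',w\}\in E_{k-1}$. *)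

theory Defs
  imports Main
begin

definition simple_graph :: "'a set \<Rightarrow> 'a set set \<Rightarrow> bool" where
  "simple_graph V E \<longleftrightarrow> (\<forall>e\<in>E. \<exists>u\<in>V. \<exists>v\<in>V. u \<noteq> v \<and> e = {u, v})"

definition graph_iso :: "'a set \<Rightarrow> 'a set set \<Rightarrow> 'b set \<Rightarrow> 'b set set \<Rightarrow> bool" where
  "graph_iso V E V' E' \<longleftrightarrow>
     (\<exists>f. bij_betw f V V' \<and> (\<forall>x\<in>V. \<forall>y\<in>V. {x, y} \<in> E \<longleftrightarrow> {f x, f y} \<in> E'))"

definition induced_edges :: "'a set set \<Rightarrow> 'a set \<Rightarrow> 'a set set" where
  "induced_edges E W = {e \<in> E. e \<subseteq> W}"

definition contains_induced :: "'a set \<Rightarrow> 'a set set \<Rightarrow> 'b set \<Rightarrow> 'b set set \<Rightarrow> bool" where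
  "contains_induced V E V' E' \<longleftrightarrow> (\<exists>W\<subseteq>V. graph_iso W (induced_edges E W) V' E')"

definition cycle_verts :: "nat \<Rightarrow> nat set" where
  "cycle_verts n = {..<n}"

definition cycle_edges :: "nat \<Rightarrow> nat set set" where
  "cycle_edges n = {{i, Suc i mod n} | i. i < n}"

text \<open>The \<open>n\<close>-sun: \<open>Inl i\<close> stands for \<open>u\<^sub>i\<^sub>+\<^sub>1\<close> and \<open>Inr i\<close> for \<open>w\<^sub>i\<^sub>+\<^sub>1\<close>.\<close>

definition sun_verts :: "nat \<Rightarrow> (nat + nat) set" where
  "sun_verts n = Inl ` {..<n} \<union> Inr ` {..<n}"

definition sun_edges :: "nat \<Rightarrow> (nat + nat) set set" where
  "sun_edges n =
     {{Inl i, Inl j} | i j. i < j \<and> j < n} \<union>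
     {{Inr i, Inl i} | i. i < n} \<union>
     {{Inr i, Inl (Suc i mod n)} | i. i < n}"

definition chordal :: "'a set \<Rightarrow> 'a set set \<Rightarrow> bool" where
  "chordal V E \<longleftrightarrow> (\<forall>n>3. \<not> contains_induced V E (cycle_verts n) (cycle_edges n))"

definition strongly_chordal :: "'a set \<Rightarrow> 'a set set \<Rightarrow> bool" where
  "strongly_chordal V E \<longleftrightarrow>
     chordal V E \<and> (\<forall>n\<ge>3. \<not> contains_induced V E (sun_verts n) (sun_edges n))"

definition is_path :: "'a set set \<Rightarrow> 'a list \<Rightarrow> bool" where
  "is_path F p \<longleftrightarrow> p \<noteq> [] \<and> distinct p \<and> successively (\<lambda>u v. {u, v} \<in> F) p"

definition is_cycle :: "'a set set \<Rightarrow> 'a list \<Rightarrow> bool" where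
  "is_cycle F p \<longleftrightarrow> length p \<ge> 3 \<and> is_path F p \<and> {last p, hd p} \<in> F"

definition forest :: "'a set set \<Rightarrow> bool" where
  "forest F \<longleftrightarrow> (\<nexists>p. is_cycle F p)"

definition cl :: "'a set set \<Rightarrow> 'a set set \<Rightarrow> 'a set set" where
  "cl E F = {e \<in> E. \<exists>p. is_path F p \<and> e = {hd p, last p}}"

definition label_class :: "'a set set \<Rightarrow> ('a set \<Rightarrow> nat) \<Rightarrow> nat \<Rightarrow> 'a set set" where
  "label_class E lab k = {e \<in> E. lab e = k}"

definition label_upto :: "'a set set \<Rightarrow> ('a set \<Rightarrow> nat) \<Rightarrow> nat \<Rightarrow> 'a set set" where
  "label_upto E lab k = (\<Union>j\<in>{1..k}. label_class E lab j)"

text \<open>Only the values of \<open>lab\<close> on \<open>E\<close> matter.\<close>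

definition MAT_labeling :: "'a set \<Rightarrow> 'a set set \<Rightarrow> ('a set \<Rightarrow> nat) \<Rightarrow> bool" where
  "MAT_labeling V E lab \<longleftrightarrow>
     (\<forall>e\<in>E. lab e > 0) \<and>
     (\<forall>k\<ge>1.
        forest (label_class E lab k) \<and>
        cl E (label_class E lab k) \<inter> label_upto E lab (k - 1) = {} \<and>
        (\<forall>u u'. {u, u'} \<in> label_class E lab k \<longrightarrow>
           card {w \<in> V. {u, w} \<in> label_upto E lab (k - 1) \<and>
                        {u', w} \<in> label_upto E lab (k - 1)} = k - 1))"

end

theory Submission
  imports Defs "HOL-Combinatorics.Transposition"
begin

text \<open>Consider the incidence matrix of vertices against maximal cliques. A shortest special cycle
  (chordless incidence cycle of length at least three) among the maximal cliques of a chordal graph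
  has pairwise adjacent vertices and extends to an induced sun, so there is none in a strongly chordal
  graph. In a doubly lexical ordering of the matrix every submatrix with rows \<open>11\<close>, \<open>10\<close> extends to a
  special cycle; hence no such submatrix exists, which says that, when the vertices are deleted in
  this order, the traces of the cliques through the vertex being deleted always form a chain.

  The labeling is built in the reverse order, keeping all traces of maximal cliques \<^emph>\<open>good\<close>: a good set
  \<open>B\<close> has a unique pair with the largest label \<open>card B - 1\<close>, and remains good when either end of that
  pair is removed. For a chain of good sets one can list the elements so that all initial segments
  are good and every member of the chain is an initial segment. Labeling the edges from a new vertex
  to the members of this list by \<open>1, 2, \<dots>\<close> preserves both goodness and the axioms.\<close>

section \<open>Good sets\<close>

text \<open>Both removals have to leave good sets: a list that is to be extended inside
  \<open>B\<close> may contain either end of the top pair, so it is not known in advance which end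
  will be split off.\<close>

inductive good :: "('a set \<Rightarrow> nat) \<Rightarrow> 'a set \<Rightarrow> bool" for lab where
  good_empty: "good lab {}"
| good_singleton: "good lab {x}"
| good_step: "\<lbrakk>finite B; x \<in> B; y \<in> B; x \<noteq> y; lab {x, y} = card B - 1;
    \<And>u v. \<lbrakk>u \<in> B; v \<in> B; u \<noteq> v; {u, v} \<noteq> {x, y}\<rbrakk> \<Longrightarrow> lab {u, v} < card B - 1;
    good lab (B - {x}); good lab (B - {y})\<rbrakk> \<Longrightarrow> good lab B"

lemma good_label_less:
  assumes "good lab B" "u \<in> B" "v \<in> B" "u \<noteq> v"
  shows "lab {u, v} < card B"
  using assms(1)
proof cases
  case (good_step x y)
  have "card B > 0" using good_step by (simp add: card_gt_0_iff) blast
  moreover have "lab {u, v} \<le> card B - 1"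
    using good_step(5) good_step(6)[OF assms(2-4)] by (cases "{u, v} = {x, y}") auto
  ultimately show ?thesis by linarith
qed (use assms in auto)

lemma good_cong:
  assumes "good lab B" "\<And>u v. u \<in> B \<Longrightarrow> v \<in> B \<Longrightarrow> lab' {u, v} = lab {u, v}"
  shows "good lab' B"
  using assms
proof (induction rule: good.induct)
  case (good_step B x y)
  show ?case
  proof (rule good.good_step[of B x y])
    show "lab' {x, y} = card B - 1" using good_step by simp
    show "lab' {u, v} < card B - 1"
      if "u \<in> B" "v \<in> B" "u \<noteq> v" "{u, v} \<noteq> {x, y}" for u v
      using good_step.hyps(6)[OF that] good_step.prems that by simp
    show "good lab' (B - {x})" using good_step.IH(1) good_step.prems by blast
    show "good lab' (B - {y})" using good_step.IH(2) good_step.prems by blast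
  qed (use good_step in auto)
qed (auto intro: good.intros)

text \<open>As \<open>take k xs\<close> is \<open>xs\<close> for large \<open>k\<close>, goodness of
  the whole set is included.\<close>

definition good_list :: "('a set \<Rightarrow> nat) \<Rightarrow> 'a list \<Rightarrow> bool" where
  "good_list lab xs \<longleftrightarrow> distinct xs \<and> (\<forall>k. good lab (set (take k xs)))"

lemma good_list_append_one:
  assumes "good_list lab xs" "x \<notin> set xs" "good lab (insert x (set xs))"
  shows "good_list lab (xs @ [x])"
  unfolding good_list_def
proof (intro conjI allI)
  fix k
  show "good lab (set (take k (xs @ [x])))"
    using assms by (cases "k \<le> length xs") (auto simp: good_list_def)
qed (use assms in \<open>auto simp: good_list_def\<close>)

text \<open>The edge of largest label in \<open>B\<close> cannot lie inside a smaller good set, so one of its ends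
  can be split off.\<close>

lemma good_list_extend:
  assumes "good lab B" "good_list lab xs" "set xs \<subseteq> B"
  shows "\<exists>ys. good_list lab (xs @ ys) \<and> set (xs @ ys) = B"
  using assms
proof (induction rule: good.induct)
  case good_empty
  then show ?case by (intro exI[of _ "[]"]) auto
next
  case (good_singleton x)
  show ?case
  proof (cases "xs = []")
    case True
    then show ?thesis using good_list_append_one[of lab "[]" x] good_singleton
      by (intro exI[of _ "[x]"]) (auto intro: good.intros)
  next
    case False
    then show ?thesis using good_singleton
      by (intro exI[of _ "[]"]) (cases xs; auto)
  qed
next
  case (good_step B x y)
  have goodB: "good lab B" by (rule good.good_step[OF good_step.hyps]) 
  have split: ?case if "z \<in> B" "z \<notin> set xs"
    "\<exists>ys. good_list lab (xs @ ys) \<and> set (xs @ ys) = B - {z}" for z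
  proof -
    from that(3) obtain ys where ys: "good_list lab (xs @ ys)" "set (xs @ ys) = B - {z}"
      by blast
    have "insert z (set (xs @ ys)) = B" using ys that by auto
    then have "good_list lab ((xs @ ys) @ [z])"
      using good_list_append_one[OF ys(1), of z] ys(2) goodB by auto
    then show ?thesis using \<open>insert z (set (xs @ ys)) = B\<close>
      by (intro exI[of _ "ys @ [z]"]) auto
  qed
  show ?case
  proof (cases "set xs = B")
    case True
    then show ?thesis using good_step.prems by (intro exI[of _ "[]"]) auto
  next
    case False
    then have lt: "card (set xs) < card B"
      using good_step by (intro psubset_card_mono) auto
    have g: "good lab (set xs)"
      using good_step.prems(1) unfolding good_list_def by (metis order_refl take_all)
    \<comment> \<open>Labels on the good set \<open>set xs\<close> are below
      \<open>card (set xs)\<close>, hence below the label \<open>card B - 1\<close> of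
      \<open>{x, y}\<close>.\<close>
    have "\<not> (x \<in> set xs \<and> y \<in> set xs)"
      using good_label_less[OF g, of x y] good_step lt by auto
    then show ?thesis
    proof (cases "x \<in> set xs")
      case False
      then show ?thesis using good_step by (intro split[of x]) auto
    next
      case True
      then have "y \<notin> set xs" using \<open>\<not> (x \<in> set xs \<and> y \<in> set xs)\<close> by simp
      then show ?thesis using good_step by (intro split[of y]) auto
    qed
  qed
qed

text \<open>By induction, list the chain without its largest member \<open>B\<close> and extend that
  list inside \<open>B\<close>; an extension keeps the old initial segments.\<close>

lemma good_chain_list:
  assumes "finite \<C>" "\<And>C. C \<in> \<C> \<Longrightarrow> good lab C"
    "\<And>C D. C \<in> \<C> \<Longrightarrow> D \<in> \<C> \<Longrightarrow> C \<subseteq> D \<or> D \<subseteq> C"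
  shows "\<exists>xs. good_list lab xs \<and> set xs = \<Union>\<C> \<and> (\<forall>C\<in>\<C>. \<exists>k. C = set (take k xs))"
  using assms
proof (induction "card \<C>" arbitrary: \<C> rule: less_induct)
  case less
  show ?case
  proof (cases "\<C> = {}")
    case True
    then show ?thesis by (intro exI[of _ "[]"]) (auto simp: good_list_def good_empty)
  next
    case False
    then obtain B where B: "B \<in> \<C>" "\<And>C. C \<in> \<C> \<Longrightarrow> B \<subseteq> C \<Longrightarrow> C = B"
      using finite_has_maximal[OF less.prems(1)] by metis
    have Bmax: "C \<subseteq> B" if "C \<in> \<C>" for C using B that less.prems(3) by blast
    have "card (\<C> - {B}) < card \<C>" using B(1) less.prems(1) by (meson card_Diff1_less)
    then obtain xs where xs: "good_list lab xs" "set xs = \<Union>(\<C> - {B})"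
      "\<forall>C\<in>\<C> - {B}. \<exists>k. C = set (take k xs)"
      using less.hyps[of "\<C> - {B}"] less.prems by blast
    have "set xs \<subseteq> B" using xs(2) Bmax by auto
    then obtain ys where ys: "good_list lab (xs @ ys)" "set (xs @ ys) = B"
      using good_list_extend[OF less.prems(2)[OF B(1)] xs(1)] by blast
    have "\<exists>k. C = set (take k (xs @ ys))" if C: "C \<in> \<C>" for C
    proof (cases "C = B")
      case True
      then show ?thesis using ys(2) by (intro exI[of _ "length (xs @ ys)"]) auto
    next
      case False
      then obtain k where "C = set (take k xs)" using xs(3) C by blast
      \<comment> \<open>Capping \<open>k\<close> at \<open>length xs\<close> keeps the prefix from
        running into \<open>ys\<close>.\<close>
      then show ?thesis by (intro exI[of _ "min k (length xs)"]) (auto simp: min_def)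
    qed
    then show ?thesis using ys Bmax B(1) by (intro exI[of _ "xs @ ys"]) auto
  qed
qed

text \<open>In a set of \<open>k + 2\<close> elements the top pair is \<open>v\<close> with the last
  entry \<open>xs ! k\<close>, labeled \<open>Suc k\<close>. Removing \<open>v\<close> leaves an
  initial segment of \<open>xs\<close>; removing \<open>xs ! k\<close> leaves the set of the
  previous induction step.\<close>

lemma good_insert_take:
  assumes "good_list lab xs" "v \<notin> set xs" "\<And>k. k < length xs \<Longrightarrow> lab {v, xs ! k} = Suc k"
    "k \<le> length xs"
  shows "good lab (insert v (set (take k xs)))"
  using assms(4)
proof (induction k)
  case 0
  then show ?case by (simp add: good_singleton)
next
  case (Suc k)
  let ?a = "xs ! k" and ?P = "set (take k xs)" and ?Q = "set (take (Suc k) xs)"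
  have dist: "distinct xs" and good: "\<And>k. good lab (set (take k xs))"
    using assms(1) by (auto simp: good_list_def)
  have Q: "?Q = insert ?a ?P" using Suc.prems by (simp add: take_Suc_conv_app_nth)
  have aP: "?a \<notin> ?P" using dist Suc.prems
    by (auto simp: in_set_conv_nth nth_eq_iff_index_eq)
  have vQ: "v \<notin> ?Q" using assms(2) by (meson in_set_takeD)
  have cQ: "card ?Q = Suc k" using dist Suc.prems by (simp add: distinct_card)
  have card: "card (insert v ?Q) - 1 = Suc k" using cQ vQ by simp
  have va: "v \<noteq> ?a" using vQ Q by auto
  show ?case
  proof (rule good_step[of _ v ?a])
    show "lab {v, ?a} = card (insert v ?Q) - 1" using card assms(3) Suc.prems by simp
    show "good lab (insert v ?Q - {v})" using good vQ by simp
    have "insert v ?Q - {?a} = insert v ?P" using Q aP va by auto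
    then show "good lab (insert v ?Q - {?a})" using Suc by simp
    have new: "lab {v, u} < Suc k" if "u \<in> ?P" for u
    proof -
      obtain i where "i < k" "i < length xs" "u = xs ! i"
        using \<open>u \<in> ?P\<close> by (auto simp: in_set_conv_nth)
      then show ?thesis using assms(3) by simp
    qed
    show "lab {u, w} < card (insert v ?Q) - 1"
      if uw: "u \<in> insert v ?Q" "w \<in> insert v ?Q" "u \<noteq> w" "{u, w} \<noteq> {v, ?a}" for u w
    proof -
      consider "u \<in> ?Q" "w \<in> ?Q" | "u = v" "w \<in> ?P" | "w = v" "u \<in> ?P"
        using uw unfolding Q by blast
      then show ?thesis
      proof cases
        case 1
        then show ?thesis using good_label_less[OF good 1 uw(3)] cQ card by simp
      next
        case 2
        then show ?thesis using new card by simp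
      next
        case 3
        then show ?thesis using new card by (simp add: insert_commute)
      qed
    qed
  qed (use Q va in auto)
qed

section \<open>Inserting a vertex\<close>

lemma is_path_rev: "is_path F p \<Longrightarrow> is_path F (rev p)"
  by (auto simp: is_path_def insert_commute successively_rev)

lemma is_cycle_nth_edge:
  assumes "is_cycle F p" "i < length p"
  shows "{p ! i, p ! (Suc i mod length p)} \<in> F"
proof (cases "Suc i < length p")
  case True
  then show ?thesis using assms by (auto simp: is_cycle_def is_path_def successively_conv_nth)
next
  case False
  then have "Suc i = length p" using assms by simp
  moreover have "p \<noteq> []" using assms(2) by auto
  ultimately have "p ! (Suc i mod length p) = hd p" "p ! i = last p"
    by (simp_all add: hd_conv_nth last_conv_nth flip: \<open>Suc i = length p\<close>)
  then show ?thesis using assms(1) by (simp add: is_cycle_def)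
qed

text \<open>With its counterpart for paths, this keeps a new vertex, which has at most one edge in
  each label class, off cycles and out of the interior of paths within one class.\<close>

lemma cycle_two_neighbours:
  assumes "is_cycle F p" "v \<in> set p"
  shows "\<exists>a b. a \<noteq> b \<and> {v, a} \<in> F \<and> {v, b} \<in> F"
proof -
  let ?n = "length p"
  have n: "?n \<ge> 3" and d: "distinct p" using assms by (auto simp: is_cycle_def is_path_def)
  obtain i where i: "i < ?n" "p ! i = v" using assms(2) by (auto simp: in_set_conv_nth)
  \<comment> \<open>The cyclic predecessor of \<open>i\<close>; it differs from the successor
    because the cycle has at least three vertices.\<close>
  define j where "j = (if i = 0 then ?n - 1 else i - 1)"
  have j: "j < ?n" "Suc j mod ?n = i" using i n by (auto simp: j_def)
  have "j \<noteq> Suc i mod ?n"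
    using i n by (cases "Suc i = ?n") (auto simp: j_def)
  then have "p ! j \<noteq> p ! (Suc i mod ?n)"
    using d j(1) n by (subst nth_eq_iff_index_eq) (auto intro!: mod_less_divisor)
  moreover have "{v, p ! (Suc i mod ?n)} \<in> F" using is_cycle_nth_edge[OF assms(1) i(1)] i by simp
  moreover have "{v, p ! j} \<in> F"
    using is_cycle_nth_edge[OF assms(1) j(1)] i j by (simp add: insert_commute)
  ultimately show ?thesis by blast
qed

lemma path_interior_two_neighbours:
  assumes "is_path F p" "v \<in> set p" "v \<noteq> hd p" "v \<noteq> last p"
  shows "\<exists>a b. a \<noteq> b \<and> {v, a} \<in> F \<and> {v, b} \<in> F"
proof -
  obtain i where i: "i < length p" "p ! i = v" using assms(2) by (auto simp: in_set_conv_nth)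
  have "i \<noteq> 0" using i assms(3) by (metis gr_implies_not0 hd_conv_nth length_0_conv)
  have "i \<noteq> length p - 1" using i assms(4)
    by (metis assms(1) is_path_def last_conv_nth)
  with i have si: "Suc i < length p" by simp
  have "p ! (i - 1) \<noteq> p ! Suc i"
    using assms(1) si by (auto simp: is_path_def nth_eq_iff_index_eq)
  moreover have "{v, p ! Suc i} \<in> F" "{p ! (i - 1), v} \<in> F"
    using assms(1) si i \<open>i \<noteq> 0\<close> successively_nth[of "\<lambda>u v. {u, v} \<in> F" p "i - 1"]
    by (auto simp: is_path_def successively_conv_nth)
  ultimately show ?thesis by (metis insert_commute)
qed

lemma is_path_subset:
  assumes "is_path F p" "\<And>a b. a \<in> set p \<Longrightarrow> b \<in> set p \<Longrightarrow> {a, b} \<in> F \<Longrightarrow> {a, b} \<in> F'"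
  shows "is_path F' p"
  using assms(1) unfolding is_path_def successively_conv_nth
  by (meson Suc_lessD assms(2) nth_mem)

lemma in_set_take_iff: "x \<in> set (take k xs) \<longleftrightarrow> (\<exists>i<length xs. i < k \<and> x = xs ! i)"
  by (metis (no_types, lifting) in_set_conv_nth length_take min_less_iff_conj nth_take)

lemma mem_label_upto: "e \<in> label_upto E lab k \<longleftrightarrow> e \<in> E \<and> 1 \<le> lab e \<and> lab e \<le> k"
  by (auto simp: label_upto_def label_class_def)

text \<open>The new vertex \<open>v\<close> has at most one edge of each label, so no cycle of a
  label class passes through it (ML1). A path that violates (ML2) and starts at \<open>v\<close>
  yields a shorter violation in the old graph. For (ML3), the common neighbours of \<open>v\<close>
  and \<open>xs ! i\<close> below label \<open>Suc i\<close> are exactly the \<open>i\<close>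
  earlier entries, and \<open>small\<close> keeps \<open>v\<close> from being counted for an old
  edge.\<close>

lemma MAT_labeling_insert:
  assumes mat: "MAT_labeling W E' lab'" and v: "v \<notin> W" and sub: "\<And>e. e \<in> E' \<Longrightarrow> e \<subseteq> W"
    and xs: "distinct xs" "set xs \<subseteq> W"
    and no_loop: "\<And>x. {x} \<notin> E'"
    and edge: "\<And>i k. i < k \<Longrightarrow> k < length xs \<Longrightarrow> {xs ! i, xs ! k} \<in> E'"
    and small: "\<And>i k. i < k \<Longrightarrow> k < length xs \<Longrightarrow> lab' {xs ! i, xs ! k} \<le> k"
    and old: "\<And>e. e \<in> E' \<Longrightarrow> lab e = lab' e"
    and new: "\<And>k. k < length xs \<Longrightarrow> lab {v, xs ! k} = Suc k"
    and E: "E = E' \<union> (\<lambda>x. {v, x}) ` set xs"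
  shows "MAT_labeling (insert v W) E lab"
proof -
  have vE': "v \<notin> e" if "e \<in> E'" for e using sub[OF that] v by auto
  have newE: "{v, a} \<in> E \<longleftrightarrow> a \<in> set xs" for a
    using vE'[of "{v, a}"] unfolding E by (auto simp: doubleton_eq_iff)
  have oldE: "e \<in> E \<longleftrightarrow> e \<in> E'" if "v \<notin> e" for e using that unfolding E by auto
  have class_old: "e \<in> label_class E lab k \<longleftrightarrow> e \<in> label_class E' lab' k" if "v \<notin> e" for e k
    using oldE[OF that] old by (auto simp: label_class_def)
  have upto_old: "e \<in> label_upto E lab k \<longleftrightarrow> e \<in> label_upto E' lab' k" if "v \<notin> e" for e k
    using oldE[OF that] old by (auto simp: mem_label_upto)
  have class_new: "\<exists>i < length xs. a = xs ! i \<and> k = Suc i" if "{v, a} \<in> label_class E lab k" for a k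
    using that newE[of a] new by (auto simp: label_class_def in_set_conv_nth)
  have upto_new: "{v, a} \<in> label_upto E lab k \<longleftrightarrow> (\<exists>i < length xs. a = xs ! i \<and> i < k)" for a k
    using newE[of a] new by (auto simp: mem_label_upto in_set_conv_nth)
  have unique: "a = b" if "{v, a} \<in> label_class E lab k" "{v, b} \<in> label_class E lab k" for a b k
    using class_new[OF that(1)] class_new[OF that(2)] by auto
  have pos: "lab e > 0" if "e \<in> E" for e
    using that mat old new unfolding E MAT_labeling_def by (auto simp: in_set_conv_nth)
  have old_path: "is_path (label_class E' lab' k) p"
    if "is_path (label_class E lab k) p" "v \<notin> set p" for k p
  proof (rule is_path_subset[OF that(1)])
    show "{a, b} \<in> label_class E' lab' k"
      if "a \<in> set p" "b \<in> set p" "{a, b} \<in> label_class E lab k" for a b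
      using class_old[of "{a, b}" k] that \<open>v \<notin> set p\<close> by auto
  qed
  have "forest (label_class E lab k)" if k: "k \<ge> 1" for k
    unfolding forest_def
  proof
    assume "\<exists>p. is_cycle (label_class E lab k) p"
    then obtain p where p: "is_cycle (label_class E lab k) p" by blast
    have vp: "v \<notin> set p" using cycle_two_neighbours[OF p] unique by metis
    moreover have "hd p \<in> set p" "last p \<in> set p" "{last p, hd p} \<in> label_class E lab k"
      using p by (auto simp: is_cycle_def is_path_def)
    ultimately have "{last p, hd p} \<in> label_class E' lab' k"
      using class_old[of "{last p, hd p}" k] by auto
    then have "is_cycle (label_class E' lab' k) p"
      using p old_path vp by (auto simp: is_cycle_def)
    then show False using mat k by (auto simp: MAT_labeling_def forest_def)
  qed
  moreover have "cl E (label_class E lab k) \<inter> label_upto E lab (k - 1) = {}" if k: "k \<ge> 1" for k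
  proof (rule ccontr)
    assume "\<not> ?thesis"
    then obtain p where p: "is_path (label_class E lab k) p"
      and e: "{hd p, last p} \<in> label_upto E lab (k - 1)"
      by (auto simp: cl_def)
    have ml2: "cl E' (label_class E' lab' k) \<inter> label_upto E' lab' (k - 1) = {}"
      using mat k by (auto simp: MAT_labeling_def)
    \<comment> \<open>The first edge leads to \<open>xs ! i\<close> with \<open>k = Suc i\<close>,
      and the path ends at some \<open>xs ! j\<close> with \<open>j < i\<close>. The old edge
      between these two has label at most \<open>i\<close>, so the path without \<open>v\<close>
      already violates (ML2) for \<open>lab'\<close>.\<close>
    have start: False if p: "is_path (label_class E lab k) p" "hd p = v"
      and e: "{hd p, last p} \<in> label_upto E lab (k - 1)" for p
    proof -
      obtain q where q: "p = v # q" using p by (cases p) (auto simp: is_path_def)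
      have lastp: "last p \<noteq> v"
      proof
        assume "last p = v"
        then have "{v, v} \<in> label_upto E lab (k - 1)" using e p by simp
        then have "v \<in> set xs" using newE[of v] by (simp add: mem_label_upto)
        then show False using xs v by auto
      qed
      then have "q \<noteq> []" using q by auto
      then obtain a r where a: "q = a # r" by (cases q) auto
      have va: "{v, a} \<in> label_class E lab k" and vq: "v \<notin> set q"
        and "is_path (label_class E lab k) q"
        using p q a by (auto simp: is_path_def)
      then have pq: "is_path (label_class E' lab' k) q" using old_path by blast
      obtain i where i: "i < length xs" "a = xs ! i" "k = Suc i" using class_new[OF va] by auto
      have "{v, last q} \<in> label_upto E lab (k - 1)" using e p q \<open>q \<noteq> []\<close> by simp
      then obtain j where j: "j < length xs" "last q = xs ! j" "j < i"
        using upto_new i by auto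
      have "{a, last q} \<in> E'" using edge[of j i] i j by (simp add: insert_commute)
      moreover have "lab' {a, last q} \<le> i" using small[of j i] i j by (simp add: insert_commute)
      moreover have "lab' {a, last q} > 0"
        using mat \<open>{a, last q} \<in> E'\<close> by (simp add: MAT_labeling_def)
      ultimately have "{hd q, last q} \<in> label_upto E' lab' (k - 1)" "{hd q, last q} \<in> E'"
        using i a by (auto simp: mem_label_upto)
      then have "{hd q, last q} \<in> cl E' (label_class E' lab' k) \<inter> label_upto E' lab' (k - 1)"
        using pq by (auto simp: cl_def)
      then show False using ml2 by blast
    qed
    have "hd p \<noteq> v" using start p e by blast
    moreover have "last p \<noteq> v"
    proof
      assume l: "last p = v"
      have "p \<noteq> []" using p by (simp add: is_path_def)
      then show False using start[OF is_path_rev[OF p]] e l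
        by (simp add: hd_rev last_rev insert_commute)
    qed
    ultimately have vp: "v \<notin> set p"
      using path_interior_two_neighbours[OF p] unique by metis
    have "p \<noteq> []" using p by (simp add: is_path_def)
    then have "{hd p, last p} \<in> label_upto E' lab' (k - 1)"
      using upto_old e vp \<open>hd p \<noteq> v\<close> \<open>last p \<noteq> v\<close> by simp
    then have "{hd p, last p} \<in> cl E' (label_class E' lab' k) \<inter> label_upto E' lab' (k - 1)"
      using old_path[OF p vp] by (auto simp: cl_def mem_label_upto)
    then show False using ml2 by blast
  qed
  moreover have "card {w \<in> insert v W. {u, w} \<in> label_upto E lab (k - 1) \<and>
      {u', w} \<in> label_upto E lab (k - 1)} = k - 1"
    if k: "k \<ge> 1" and uu': "{u, u'} \<in> label_class E lab k" for k u u'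
  proof -
    have new_case: "{w \<in> insert v W. {v, w} \<in> label_upto E lab (k - 1) \<and>
      {a, w} \<in> label_upto E lab (k - 1)} = set (take (k - 1) xs) \<and> k - 1 < length xs"
      if va: "{v, a} \<in> label_class E lab k" for a
    proof -
      obtain i where i: "i < length xs" "a = xs ! i" "k = Suc i" using class_new[OF va] by auto
      have "{a, xs ! j} \<in> label_upto E lab i" if j: "j < i" for j
      proof -
        have e: "{xs ! j, xs ! i} \<in> E'" using edge j i by simp
        then show ?thesis using small[OF j i(1)] pos[of "{xs ! j, xs ! i}"] old[OF e] i(2)
          unfolding mem_label_upto E by (simp add: insert_commute)
      qed
      moreover have "xs ! j \<in> W" if "j < i" for j using that i xs by auto
      moreover have "w \<in> set (take i xs) \<longleftrightarrow> (\<exists>j < length xs. w = xs ! j \<and> j < i)" for w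
        unfolding in_set_take_iff by blast
      ultimately show ?thesis using i by (auto simp: upto_new)
    qed
    consider "u = v" | "u' = v" | "u \<noteq> v" "u' \<noteq> v" by blast
    then show ?thesis
    proof cases
      case 1
      then show ?thesis using new_case[of u'] uu' xs by (simp add: distinct_card)
    next
      case 2
      have "{w \<in> insert v W. {u, w} \<in> label_upto E lab (k - 1) \<and> {u', w} \<in> label_upto E lab (k - 1)}
        = {w \<in> insert v W. {v, w} \<in> label_upto E lab (k - 1) \<and> {u, w} \<in> label_upto E lab (k - 1)}"
        using 2 by auto
      then show ?thesis using new_case[of u] uu' xs 2 by (simp add: distinct_card insert_commute)
    next
      case 3
      have uE': "{u, u'} \<in> label_class E' lab' k" using class_old uu' 3 by simp
      \<comment> \<open>If \<open>v\<close> were counted, both ends would be entries of index below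
        \<open>k - 1\<close>, and \<open>small\<close> would give their edge a label below
        \<open>k\<close>.\<close>
      have "\<not> ({u, v} \<in> label_upto E lab (k - 1) \<and> {u', v} \<in> label_upto E lab (k - 1))"
      proof
        assume a: "{u, v} \<in> label_upto E lab (k - 1) \<and> {u', v} \<in> label_upto E lab (k - 1)"
        obtain i where i: "i < length xs" "u = xs ! i" "i < k - 1"
          using a upto_new[of u "k - 1"] by (auto simp: insert_commute)
        obtain j where j: "j < length xs" "u' = xs ! j" "j < k - 1"
          using a upto_new[of u' "k - 1"] by (auto simp: insert_commute)
        have "i \<noteq> j"
        proof
          assume "i = j"
          then have "{u} \<in> E'" using uE' i j by (simp add: label_class_def)
          then show False using no_loop by blast
        qed
        then have "lab' {u, u'} < k"
          using small[of i j] small[of j i] i j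
          by (cases i j rule: linorder_cases) (auto simp: insert_commute)
        then show False using uE' by (simp add: label_class_def)
      qed
      moreover have "{x, w} \<in> label_upto E lab (k - 1) \<longleftrightarrow> {x, w} \<in> label_upto E' lab' (k - 1)"
        if "x \<noteq> v" "w \<in> W" for x w
        using upto_old[of "{x, w}"] that v by auto
      ultimately have "{w \<in> insert v W. {u, w} \<in> label_upto E lab (k - 1) \<and> {u', w} \<in> label_upto E lab (k - 1)}
        = {w \<in> W. {u, w} \<in> label_upto E' lab' (k - 1) \<and> {u', w} \<in> label_upto E' lab' (k - 1)}"
        using 3 v by auto
      then show ?thesis using mat k uE' by (simp add: MAT_labeling_def)
    qed
  qed
  ultimately show ?thesis using pos unfolding MAT_labeling_def by blast
qed


section \<open>Elimination orders with nested traces\<close>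

definition trace_edges :: "'a set set \<Rightarrow> 'a set \<Rightarrow> 'a set set" where
  "trace_edges H W = {{x, y} | x y. x \<noteq> y \<and> x \<in> W \<and> y \<in> W \<and> (\<exists>C\<in>H. x \<in> C \<and> y \<in> C)}"

text \<open>A nest point elimination order, as for \<beta>-acyclic hypergraphs; the head is deleted
  first. The family \<open>H\<close> stays fixed and only its traces shrink, so maximal cliques need
  not be recomputed after a deletion.\<close>

fun nest_order :: "'a set set \<Rightarrow> 'a list \<Rightarrow> bool" where
  "nest_order H [] \<longleftrightarrow> True"
| "nest_order H (v # vs) \<longleftrightarrow>
     (\<forall>C\<in>H. \<forall>D\<in>H. v \<in> C \<longrightarrow> v \<in> D \<longrightarrow> C \<inter> set vs \<subseteq> D \<or> D \<inter> set vs \<subseteq> C) \<and> nest_order H vs"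

lemma doubleton_mem_trace_edges:
  "{x, y} \<in> trace_edges H W \<longleftrightarrow> x \<noteq> y \<and> x \<in> W \<and> y \<in> W \<and> (\<exists>C\<in>H. x \<in> C \<and> y \<in> C)"
  unfolding trace_edges_def by (auto simp: doubleton_eq_iff)

lemma trace_edges_insert:
  assumes "v \<notin> W"
  shows "trace_edges H (insert v W) =
    trace_edges H W \<union> (\<lambda>x. {v, x}) ` (\<Union>{C \<inter> W | C. C \<in> H \<and> v \<in> C})" (is "?L = ?R")
proof
  show "?L \<subseteq> ?R"
  proof
    fix e assume "e \<in> ?L"
    then obtain x y C where e: "e = {x, y}" "x \<noteq> y" "x \<in> insert v W" "y \<in> insert v W"
      "C \<in> H" "x \<in> C" "y \<in> C" unfolding trace_edges_def by blast
    consider "x \<in> W" "y \<in> W" | "x = v" "y \<in> W" | "y = v" "x \<in> W" using e by blast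
    then show "e \<in> ?R"
    proof cases
      case 1
      then show ?thesis using e by (auto simp: doubleton_mem_trace_edges)
    next
      case 2
      then show ?thesis using e by blast
    next
      case 3
      then have "e = {v, x}" using e by auto
      then show ?thesis using e 3 by blast
    qed
  qed
  show "?R \<subseteq> ?L"
    using assms unfolding trace_edges_def by blast
qed

text \<open>Goodness of the traces belongs to the induction: through \<open>good_chain_list\<close>
  it supplies the list along which the edges at the next vertex are labeled.\<close>

theorem nest_order_MAT_labeling:
  assumes "finite H" "distinct vs" "nest_order H vs"
  shows "\<exists>lab. MAT_labeling (set vs) (trace_edges H (set vs)) lab \<and>
    (\<forall>C\<in>H. good lab (C \<inter> set vs))"
  using assms(2,3)
proof (induction vs)
  case Nil
  have "trace_edges H {} = {}" by (auto simp: trace_edges_def)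
  moreover have "\<not> is_path {} p" if "length p \<ge> 2" for p :: "'a list"
    using that by (cases p; cases "tl p") (auto simp: is_path_def)
  ultimately show ?case
    by (auto simp: MAT_labeling_def label_class_def label_upto_def forest_def is_cycle_def cl_def
        good_empty)
next
  case (Cons v vs)
  let ?W = "set vs"
  let ?E' = "trace_edges H ?W" and ?E = "trace_edges H (insert v ?W)"
  obtain lab' where mat: "MAT_labeling ?W ?E' lab'" and good: "\<And>C. C \<in> H \<Longrightarrow> good lab' (C \<inter> ?W)"
    using Cons by auto
  define \<C> where "\<C> = {C \<inter> ?W | C. C \<in> H \<and> v \<in> C}"
  have v: "v \<notin> ?W" using Cons.prems by simp
  have chain: "C \<subseteq> D \<or> D \<subseteq> C" if "C \<in> \<C>" "D \<in> \<C>" for C D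
    using that Cons.prems(2) unfolding \<C>_def by fastforce
  have "finite \<C>" using \<open>finite H\<close> by (simp add: \<C>_def)
  moreover have "good lab' C" if "C \<in> \<C>" for C using that good by (auto simp: \<C>_def)
  ultimately have "\<exists>xs. good_list lab' xs \<and> set xs = \<Union>\<C> \<and> (\<forall>C\<in>\<C>. \<exists>k. C = set (take k xs))"
    using chain by (intro good_chain_list)
  then obtain xs where xs: "good_list lab' xs" "set xs = \<Union>\<C>"
    "\<forall>C\<in>\<C>. \<exists>k. C = set (take k xs)"
    by (elim exE conjE)
  have dist: "distinct xs" using xs by (simp add: good_list_def)
  have xsW: "set xs \<subseteq> ?W" using xs(2) by (auto simp: \<C>_def)
  \<comment> \<open>An edge at \<open>v\<close> is labeled by the position of its other end in
    \<open>xs\<close>, counted from one; the position is unique because \<open>xs\<close> is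
    distinct.\<close>
  define lab where "lab e = (if v \<in> e then Suc (THE k. k < length xs \<and> e = {v, xs ! k}) else lab' e)"
    for e
  have new: "lab {v, xs ! k} = Suc k" if "k < length xs" for k
  proof -
    have "(THE k'. k' < length xs \<and> {v, xs ! k} = {v, xs ! k'}) = k"
      using that dist by (intro the_equality) (auto simp: doubleton_eq_iff nth_eq_iff_index_eq)
    then show ?thesis by (simp add: lab_def)
  qed
  have old: "lab e = lab' e" if "v \<notin> e" for e using that by (simp add: lab_def)
  have subE: "e \<subseteq> ?W" if "e \<in> ?E'" for e using that by (auto simp: trace_edges_def)
  have edge: "{xs ! i, xs ! k} \<in> ?E'" if "i < k" "k < length xs" for i k
  proof -
    have "xs ! i \<in> \<Union>\<C>" "xs ! k \<in> \<Union>\<C>" using that xs(2) by (metis nth_mem less_trans)+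
    then obtain C D where "C \<in> \<C>" "xs ! i \<in> C" "D \<in> \<C>" "xs ! k \<in> D" by blast
    \<comment> \<open>The larger of two members of the chain contains both vertices, so they lie in
      a common clique.\<close>
    then have "\<exists>C\<in>\<C>. xs ! i \<in> C \<and> xs ! k \<in> C" using chain by blast
    moreover have "xs ! i \<noteq> xs ! k" using that dist by (simp add: nth_eq_iff_index_eq)
    ultimately show ?thesis by (auto simp: \<C>_def doubleton_mem_trace_edges)
  qed
  \<comment> \<open>The first \<open>k + 1\<close> entries form a good set, so its labels are at
    most \<open>k\<close>.\<close>
  have small: "lab' {xs ! i, xs ! k} \<le> k" if "i < k" "k < length xs" for i k
  proof -
    have "xs ! i \<in> set (take (Suc k) xs)" "xs ! k \<in> set (take (Suc k) xs)"
      using that by (auto simp: in_set_take_iff intro: exI[of _ i] exI[of _ k])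
    moreover have "xs ! i \<noteq> xs ! k" using that dist by (simp add: nth_eq_iff_index_eq)
    moreover have "card (set (take (Suc k) xs)) = Suc k" using that dist by (simp add: distinct_card)
    ultimately show ?thesis
      using good_label_less[of lab' "set (take (Suc k) xs)" "xs ! i" "xs ! k"] xs(1)
      by (simp add: good_list_def)
  qed
  have "MAT_labeling (insert v ?W) ?E lab"
  proof (rule MAT_labeling_insert[OF mat v])
    show "?E = ?E' \<union> (\<lambda>x. {v, x}) ` set xs"
      unfolding trace_edges_insert[OF v] xs(2) \<C>_def ..
    show "{x} \<notin> ?E'" for x using doubleton_mem_trace_edges[of x x] by simp
    show "lab e = lab' e" if "e \<in> ?E'" for e using subE[OF that] v old by blast
  qed (use subE dist xsW edge small new in auto)
  moreover have "good lab (C \<inter> insert v ?W)" if C: "C \<in> H" for C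
  proof (cases "v \<in> C")
    case False
    have "good lab (C \<inter> ?W)" using v by (intro good_cong[OF good[OF C]] old) auto
    then show ?thesis using False by simp
  next
    case True
    have "C \<inter> ?W \<in> \<C>" using C True by (auto simp: \<C>_def)
    then obtain k where k: "C \<inter> ?W = set (take k xs)" using xs(3) by blast
    have vx: "v \<notin> set xs" using xsW v by auto
    have "good_list lab xs" unfolding good_list_def
    proof (intro conjI allI dist)
      fix k
      have vk: "v \<notin> set (take k xs)" using vx by (meson in_set_takeD)
      have "good lab' (set (take k xs))" using xs(1) by (simp add: good_list_def)
      then show "good lab (set (take k xs))" by (rule good_cong) (rule old, use vk in blast)
    qed
    then have "good lab (insert v (set (take (min k (length xs)) xs)))"
      using new vx by (intro good_insert_take) auto
    moreover have "set (take (min k (length xs)) xs) = C \<inter> ?W" using k by (simp add: min_def)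
    moreover have "C \<inter> insert v ?W = insert v (C \<inter> ?W)" using True by auto
    ultimately show ?thesis by simp
  qed
  ultimately show ?case by auto
qed

section \<open>Doubly lexical orderings\<close>

text \<open>Binary numbers are compared at the highest digit where they differ. At \<open>j\<close>
  the digits stand in the wrong order for \<le>, so that highest difference lies above
  \<open>j\<close> and favours \<open>Q\<close>.\<close>

lemma binary_le_last_difference:
  fixes P Q :: "nat \<Rightarrow> bool"
  assumes "(\<Sum>j<q. of_bool (P j) * 2 ^ j) \<le> (\<Sum>j<q. of_bool (Q j) * (2::nat) ^ j)"
    "P j" "\<not> Q j" "j < q"
  shows "\<exists>j'>j. j' < q \<and> \<not> P j' \<and> Q j' \<and> (\<forall>l. j' < l \<and> l < q \<longrightarrow> P l = Q l)"
  using assms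
proof (induction q)
  case (Suc q)
  have bound: "(\<Sum>j<q. of_bool (R j) * (2::nat) ^ j) < 2 ^ q" for R :: "nat \<Rightarrow> bool"
    by (induction q) auto
  consider "P q = Q q" | "P q" "\<not> Q q" | "\<not> P q" "Q q" by blast
  then show ?case
  proof cases
    case 1
    then have "j \<noteq> q" using Suc.prems by auto
    then obtain j' where "j' > j" "j' < q" "\<not> P j'" "Q j'" "\<forall>l. j' < l \<and> l < q \<longrightarrow> P l = Q l"
      using Suc 1 by auto
    then show ?thesis using 1 by (intro exI[of _ j']) (auto simp: less_Suc_eq)
  next
    case 2
    then show ?thesis using Suc.prems(1) bound[of Q] by simp
  next
    case 3
    then have "j \<noteq> q" using Suc.prems by auto
    then show ?thesis using Suc.prems 3 by (intro exI[of _ q]) auto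
  qed
qed simp

text \<open>The rearrangement inequality for one inversion: the larger value moves to the larger
  weight.\<close>

lemma weighted_sum_transpose_less:
  fixes f :: "nat \<Rightarrow> nat"
  assumes "i < i'" "i' < p" "f i' < f i"
  shows "(\<Sum>k<p. f k * 2 ^ k) < (\<Sum>k<p. f (transpose i i' k) * 2 ^ k)"
proof -
  let ?A = "{..<p} - {i, i'}"
  have split: "(\<Sum>k<p. g k * 2 ^ k) = g i * 2 ^ i + (g i' * 2 ^ i' + (\<Sum>k\<in>?A. g k * 2 ^ k))"
    for g :: "nat \<Rightarrow> nat"
  proof -
    have "{..<p} = insert i (insert i' ?A)" using assms by auto
    then have "(\<Sum>k<p. g k * 2 ^ k) = (\<Sum>k\<in>insert i (insert i' ?A). g k * 2 ^ k)" by simp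
    then show ?thesis using assms(1) by simp
  qed
  have sum_eq: "(\<Sum>k\<in>?A. f (transpose i i' k) * 2 ^ k) = (\<Sum>k\<in>?A. f k * 2 ^ k)"
    by (intro sum.cong) (auto simp: transpose_def)
  define d where "d = f i - f i'"
  have d: "f i = f i' + d" "d > 0" using assms(3) by (auto simp: d_def)
  have "d * 2 ^ i < d * (2::nat) ^ i'" using d(2) assms(1) by simp
  then have "f i * 2 ^ i + f i' * 2 ^ i' < f i' * 2 ^ i + f i * 2 ^ i'"
    unfolding d(1) distrib_right by linarith
  then show ?thesis
    using sum_eq by (simp add: split[of f] split[of "\<lambda>k. f (transpose i i' k)"])
qed

text \<open>Equivalent to the rows being in nondecreasing lexicographic order with the last column
  most significant; equal rows are allowed. This form returns the last difference, the column needed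
  to prolong a zigzag.\<close>

definition lex_rows :: "nat \<Rightarrow> nat \<Rightarrow> (nat \<Rightarrow> nat \<Rightarrow> bool) \<Rightarrow> bool" where
  "lex_rows p q M \<longleftrightarrow> (\<forall>i i' j. i < i' \<longrightarrow> i' < p \<longrightarrow> j < q \<longrightarrow> M i j \<longrightarrow> \<not> M i' j \<longrightarrow>
     (\<exists>j'>j. j' < q \<and> \<not> M i j' \<and> M i' j' \<and> (\<forall>l. j' < l \<and> l < q \<longrightarrow> M i l = M i' l)))"

lemma bij_betw_comp_transpose:
  assumes "bij_betw g {..<n} S" "i < n" "i' < n"
  shows "bij_betw (\<lambda>k. g (transpose i i' k)) {..<n} S"
proof -
  have "bij_betw (transpose i i') {..<n} {..<n}" using assms by simp
  then show ?thesis using bij_betw_trans[OF _ assms(1)] by (simp add: comp_def)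
qed

text \<open>Among all pairs of enumerations, choose one that maximizes the sum of
  \<open>2 ^ (i + j)\<close> over the incidences \<open>M (v i) (h j)\<close>. With rows, or
  columns, read as binary numbers, swapping two that are out of order would increase this
  weight.\<close>

lemma doubly_lexical_enumeration:
  fixes M :: "'a \<Rightarrow> 'b \<Rightarrow> bool"
  assumes "finite V" "finite H"
  shows "\<exists>v h. bij_betw v {..<card V} V \<and> bij_betw h {..<card H} H \<and>
    lex_rows (card V) (card H) (\<lambda>i j. M (v i) (h j)) \<and>
    lex_rows (card H) (card V) (\<lambda>j i. M (v i) (h j))"
proof -
  let ?p = "card V" and ?q = "card H"
  define bij where "bij = (\<lambda>(v, h). bij_betw v {..<?p} V \<and> bij_betw h {..<?q} H)"
  define weight where "weight = (\<lambda>(v, h). \<Sum>i<?p. (\<Sum>j<?q. of_bool (M (v i) (h j)) * 2 ^ j) * (2::nat) ^ i)"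
  have "\<exists>f. bij f"
    using ex_bij_betw_nat_finite[OF assms(1)] ex_bij_betw_nat_finite[OF assms(2)]
    unfolding bij_def atLeast0LessThan by auto
  then obtain f0 where f0: "bij f0" ..
  have "(\<Sum>j<?q. of_bool (M (v i) (h j)) * 2 ^ j) \<le> (\<Sum>j<?q. (2::nat) ^ j)" for v h i
    by (intro sum_mono) simp
  then have "weight f \<le> (\<Sum>i<?p. (\<Sum>j<?q. 2 ^ j) * 2 ^ i)" for f
    unfolding weight_def by (cases f) (simp only: case_prod_conv, intro sum_mono mult_right_mono, auto)
  then have "\<forall>f. bij f \<longrightarrow> weight f < Suc (\<Sum>i<?p. (\<Sum>j<?q. 2 ^ j) * 2 ^ i)"
    using less_Suc_eq_le by blast
  then obtain f where f: "bij f" "\<And>g. bij g \<Longrightarrow> weight g \<le> weight f"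
    using ex_has_greatest_nat[of bij f0 weight] f0 by blast
  obtain v h where vh: "f = (v, h)" by (cases f)
  have v: "bij_betw v {..<?p} V" and h: "bij_betw h {..<?q} H" using f vh by (auto simp: bij_def)
  have "lex_rows ?p ?q (\<lambda>i j. M (v i) (h j))"
    unfolding lex_rows_def
  proof (intro allI impI)
    fix i i' j assume a: "i < i'" "i' < ?p" "j < ?q" "M (v i) (h j)" "\<not> M (v i') (h j)"
    let ?f = "\<lambda>i. \<Sum>j<?q. of_bool (M (v i) (h j)) * (2::nat) ^ j"
    have "\<not> ?f i' < ?f i"
    proof
      assume "?f i' < ?f i"
      then have "weight (v, h) < weight ((\<lambda>k. v (transpose i i' k)), h)"
        using weighted_sum_transpose_less[OF a(1,2), of ?f] by (simp add: weight_def)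
      moreover have "bij ((\<lambda>k. v (transpose i i' k)), h)"
        using bij_betw_comp_transpose[OF v] a h by (simp add: bij_def)
      ultimately show False using f(2) vh by (simp add: leD)
    qed
    then show "\<exists>j'>j. j' < ?q \<and> \<not> M (v i) (h j') \<and> M (v i') (h j') \<and>
        (\<forall>l. j' < l \<and> l < ?q \<longrightarrow> M (v i) (h l) = M (v i') (h l))"
      using a by (intro binary_le_last_difference) auto
  qed
  moreover have "lex_rows ?q ?p (\<lambda>j i. M (v i) (h j))"
    unfolding lex_rows_def
  proof (intro allI impI)
    fix j j' i assume a: "j < j'" "j' < ?q" "i < ?p" "M (v i) (h j)" "\<not> M (v i) (h j')"
    let ?f = "\<lambda>j. \<Sum>i<?p. of_bool (M (v i) (h j)) * (2::nat) ^ i"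
    \<comment> \<open>Exchanging the sums presents the same weight as a weighted sum of column
      values, so the argument for rows carries over.\<close>
    have weight: "weight (v, h) = (\<Sum>j<?q. (\<Sum>i<?p. of_bool (M (v i) (h j)) * 2 ^ i) * 2 ^ j)" for v h
      unfolding weight_def case_prod_conv sum_distrib_right
      by (subst sum.swap) (simp only: mult_ac)
    have "\<not> ?f j' < ?f j"
    proof
      assume "?f j' < ?f j"
      then have "weight (v, h) < weight (v, (\<lambda>k. h (transpose j j' k)))"
        using weighted_sum_transpose_less[OF a(1,2), of ?f] by (simp add: weight)
      moreover have "bij (v, (\<lambda>k. h (transpose j j' k)))"
        using bij_betw_comp_transpose[OF h] a v by (simp add: bij_def)
      ultimately show False using f(2) vh by (simp add: leD)
    qed
    then show "\<exists>i'>i. i' < ?p \<and> \<not> M (v i') (h j) \<and> M (v i') (h j') \<and>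
        (\<forall>l. i' < l \<and> l < ?p \<longrightarrow> M (v l) (h j) = M (v l) (h j'))"
      using a by (intro binary_le_last_difference) auto
  qed
  ultimately show ?thesis using v h by blast
qed

section \<open>From a forbidden submatrix to a special cycle\<close>

lemma zigzag_new_column:
  assumes lex: "lex_rows p q M" and k: "0 < k" "r (k - 1) < r k" "r k < p" "c k < q"
    and mono: "\<And>a. a < k \<Longrightarrow> c a < c (Suc a)"
    and corner: "M (r (k - 1)) (c k)" "\<not> M (r k) (c k)"
    and agree: "\<And>a l. \<lbrakk>a + 2 \<le> k; c (a + 2) < l; l < q\<rbrakk> \<Longrightarrow> M (r a) l = M (r (Suc a)) l"
  obtains c' where "c k < c'" "c' < q" "M (r k) c'" "\<And>a. a < k \<Longrightarrow> \<not> M (r a) c'"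
    "\<And>l. c' < l \<Longrightarrow> l < q \<Longrightarrow> M (r (k - 1)) l = M (r k) l"
proof -
  obtain c' where c': "c k < c'" "c' < q" "\<not> M (r (k - 1)) c'" "M (r k) c'"
    "\<forall>l. c' < l \<and> l < q \<longrightarrow> M (r (k - 1)) l = M (r k) l"
    using lex[unfolded lex_rows_def, rule_format, OF k(2-4) corner] by blast
  \<comment> \<open>The zero of row \<open>r (k - 1)\<close> in the new column spreads to all
    earlier rows: rows \<open>r a\<close> and \<open>r (Suc a)\<close> agree beyond column
    \<open>c (a + 2)\<close>, and \<open>c'\<close> lies beyond all these columns.\<close>
  have "\<not> M (r a) c'" if "a < k" for a
  proof -
    have "a \<le> k - 1" using that by simp
    then show ?thesis
    proof (induction rule: inc_induct)
      case base
      then show ?case using c' by simp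
    next
      case (step a)
      have "a + 2 \<le> k" using step by simp
      then have "c (a + 2) \<le> c k"
        by (induction rule: inc_induct) (auto dest!: mono)
      then show ?case using agree[of a c'] step c' by simp
    qed
  qed
  then show thesis using c' that by blast
qed

text \<open>The incidence graph of the chosen rows and columns is an induced path with middle edge
  \<open>r 0\<close>, \<open>c 0\<close> and ends \<open>r k\<close>, \<open>c k\<close>. The last
  two conditions record that \<open>c (a + 2)\<close> and \<open>r (a + 2)\<close> were chosen as
  last differences; they exclude chords to later rows and columns.\<close>

definition zigzag :: "nat \<Rightarrow> nat \<Rightarrow> nat \<Rightarrow> (nat \<Rightarrow> nat \<Rightarrow> bool) \<Rightarrow> (nat \<Rightarrow> nat) \<Rightarrow> (nat \<Rightarrow> nat) \<Rightarrow> bool"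
  where "zigzag p q k M r c \<longleftrightarrow>
    (\<forall>a\<le>k. r a < p \<and> c a < q) \<and>
    (\<forall>a<k. r a < r (Suc a) \<and> c a < c (Suc a)) \<and>
    (\<forall>a\<le>k. \<forall>b\<le>k. M (r a) (c b) \<longleftrightarrow> a = Suc b \<or> b = Suc a \<or> a = 0 \<and> b = 0) \<and>
    (\<forall>a l. a + 2 \<le> k \<and> c (a + 2) < l \<and> l < q \<longrightarrow> M (r a) l = M (r (Suc a)) l) \<and>
    (\<forall>a l. a + 2 \<le> k \<and> r (a + 2) < l \<and> l < p \<longrightarrow> M l (c a) = M l (c (Suc a)))"

text \<open>Lexicographic order prolongs the path at both ends, by a column \<open>c'\<close> at
  \<open>r k\<close> and a row \<open>r'\<close> at \<open>c k\<close>. If these two are incident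
  the path closes to a chordless cycle, otherwise it is a longer zigzag.\<close>

lemma zigzag_extend:
  assumes lex: "lex_rows p q M" "lex_rows q p (\<lambda>j i. M i j)" and k: "0 < k"
    and zz: "zigzag p q k M r c"
  obtains r' c' where "zigzag p q (Suc k) M (r(Suc k := r')) (c(Suc k := c'))"
  | r' c' where "r' < p" "c' < q" "M r' c'" "M (r k) c'" "M r' (c k)"
    "\<And>a. a < k \<Longrightarrow> \<not> M (r a) c'" "\<And>a. a < k \<Longrightarrow> \<not> M r' (c a)"
proof -
  have bd: "\<And>a. a \<le> k \<Longrightarrow> r a < p \<and> c a < q"
    and mono: "\<And>a. a < k \<Longrightarrow> r a < r (Suc a) \<and> c a < c (Suc a)"
    and pat: "\<And>a b. \<lbrakk>a \<le> k; b \<le> k\<rbrakk> \<Longrightarrow> M (r a) (c b) \<longleftrightarrow> a = Suc b \<or> b = Suc a \<or> a = 0 \<and> b = 0"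
    and ac: "\<And>a l. \<lbrakk>a + 2 \<le> k; c (a + 2) < l; l < q\<rbrakk> \<Longrightarrow> M (r a) l = M (r (Suc a)) l"
    and ar: "\<And>a l. \<lbrakk>a + 2 \<le> k; r (a + 2) < l; l < p\<rbrakk> \<Longrightarrow> M l (c a) = M l (c (Suc a))"
    using zz unfolding zigzag_def by blast+
  have m: "r (k - 1) < r k" "c (k - 1) < c k" using mono[of "k - 1"] k by auto
  have cor: "M (r (k - 1)) (c k)" "M (r k) (c (k - 1))" "\<not> M (r k) (c k)" using pat k by auto
  obtain c' where c': "c k < c'" "c' < q" "M (r k) c'" "\<And>a. a < k \<Longrightarrow> \<not> M (r a) c'"
    "\<And>l. c' < l \<Longrightarrow> l < q \<Longrightarrow> M (r (k - 1)) l = M (r k) l"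
    using zigzag_new_column[OF lex(1) k m(1), of c] bd mono cor ac by blast
  obtain r' where r': "r k < r'" "r' < p" "M r' (c k)" "\<And>a. a < k \<Longrightarrow> \<not> M r' (c a)"
    "\<And>l. r' < l \<Longrightarrow> l < p \<Longrightarrow> M l (c (k - 1)) = M l (c k)"
    using zigzag_new_column[OF lex(2) k m(2), of r] bd mono cor ar by blast
  show thesis
  proof (cases "M r' c'")
    case True
    then show ?thesis using that(2)[of r' c'] c' r' by blast
  next
    case False
    let ?r = "r(Suc k := r')" and ?c = "c(Suc k := c')"
    have "zigzag p q (Suc k) M ?r ?c"
      unfolding zigzag_def
    proof (intro conjI allI impI)
      fix a assume "a \<le> Suc k"
      then show "?r a < p" "?c a < q" using bd r' c' by (auto simp: le_Suc_eq)
    next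
      fix a assume "a < Suc k"
      then show "?r a < ?r (Suc a)" "?c a < ?c (Suc a)" using mono r' c' by (auto simp: less_Suc_eq)
    next
      fix a b assume "a \<le> Suc k" "b \<le> Suc k"
      then consider "a \<le> k" "b \<le> k" | "a = Suc k" "b = Suc k" | "a = Suc k" "b \<le> k" | "a \<le> k" "b = Suc k"
        by linarith
      then show "M (?r a) (?c b) \<longleftrightarrow> a = Suc b \<or> b = Suc a \<or> a = 0 \<and> b = 0"
      proof cases
        case 1
        then show ?thesis using pat by auto
      next
        case 2
        then show ?thesis using False by simp
      next
        case 3
        then show ?thesis using r'(3,4) by (cases "b = k") auto
      next
        case 4
        then show ?thesis using c'(3,4) by (cases "a = k") auto
      qed
    next
      fix a l assume "a + 2 \<le> Suc k \<and> ?c (a + 2) < l \<and> l < q"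
      then show "M (?r a) l = M (?r (Suc a)) l"
        using ac[of a l] c'(5)[of l] by (cases "a + 2 = Suc k") (auto split: if_splits)
    next
      fix a l assume "a + 2 \<le> Suc k \<and> ?r (a + 2) < l \<and> l < p"
      then show "M l (?c a) = M l (?c (Suc a))"
        using ar[of a l] r'(5)[of l] by (cases "a + 2 = Suc k") (auto split: if_splits)
    qed
    then show ?thesis using that(1) by blast
  qed
qed

text \<open>The submatrix is a zigzag with \<open>k = 1\<close>. Row indices increase strictly and
  stay below \<open>p\<close>, so repeated extension must end, and it can only end by closing the
  path.\<close>

lemma gamma_closed_zigzag:
  assumes lex: "lex_rows p q M" "lex_rows q p (\<lambda>j i. M i j)"
    and gamma: "i < i'" "i' < p" "j < j'" "j' < q" "M i j" "M i j'" "M i' j" "\<not> M i' j'"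
  obtains N r c where "2 \<le> N" "\<And>a. a \<le> N \<Longrightarrow> r a < p" "\<And>a. a \<le> N \<Longrightarrow> c a < q"
    "\<And>a b. \<lbrakk>a \<le> N; b \<le> N\<rbrakk> \<Longrightarrow>
       M (r a) (c b) \<longleftrightarrow> a = Suc b \<or> b = Suc a \<or> a = 0 \<and> b = 0 \<or> a = N \<and> b = N"
proof (rule ccontr)
  assume contra: "\<not> thesis"
  have "\<exists>r c. zigzag p q (Suc k) M r c" for k
  proof (induction k)
    case 0
    have "zigzag p q (Suc 0) M (\<lambda>a. if a = 0 then i else i') (\<lambda>a. if a = 0 then j else j')"
      using gamma by (auto simp: zigzag_def le_Suc_eq)
    then show ?case by blast
  next
    case (Suc k)
    then obtain r c where zz: "zigzag p q (Suc k) M r c" by blast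
    show ?case
    proof (rule zigzag_extend[OF lex _ zz])
      fix r' c'
      assume new: "r' < p" "c' < q" "M r' c'" "M (r (Suc k)) c'" "M r' (c (Suc k))"
        "\<And>a. a < Suc k \<Longrightarrow> \<not> M (r a) c'" "\<And>a. a < Suc k \<Longrightarrow> \<not> M r' (c a)"
      let ?N = "Suc (Suc k)"
      let ?r = "r(?N := r')" and ?c = "c(?N := c')"
      have "M (?r a) (?c b) \<longleftrightarrow> a = Suc b \<or> b = Suc a \<or> a = 0 \<and> b = 0 \<or> a = ?N \<and> b = ?N"
        if ab: "a \<le> ?N" "b \<le> ?N" for a b
      proof -
        consider "a \<le> Suc k" "b \<le> Suc k" | "a = ?N" "b = ?N" | "a = ?N" "b \<le> Suc k" | "a \<le> Suc k" "b = ?N"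
          using ab by linarith
        then show ?thesis
        proof cases
          case 1
          then have "M (r a) (c b) \<longleftrightarrow> a = Suc b \<or> b = Suc a \<or> a = 0 \<and> b = 0"
            using zz unfolding zigzag_def by blast
          then show ?thesis using 1 by auto
        next
          case 2
          then show ?thesis using new by simp
        next
          case 3
          then show ?thesis using new(5,7) by (cases "b = Suc k") auto
        next
          case 4
          then show ?thesis using new(4,6) by (cases "a = Suc k") auto
        qed
      qed
      moreover have "?r a < p" "?c a < q" if "a \<le> ?N" for a
        using that zz new by (auto simp: zigzag_def le_Suc_eq)
      ultimately have thesis using that[of ?N ?r ?c] by simp
      then show ?thesis using contra by blast
    qed auto
  qed
  then obtain r c where zz: "zigzag p q (Suc p) M r c" by blast
  have "a \<le> r a" if "a \<le> Suc p" for a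
    using that
  proof (induction a)
    case (Suc a)
    moreover have "r a < r (Suc a)" using Suc zz by (simp add: zigzag_def)
    ultimately show ?case by simp
  qed simp
  from this[of "Suc p"] show False using zz by (auto simp: zigzag_def)
qed

text \<open>The closing clique \<open>L\<close> is kept apart from the \<open>K i\<close>, so that
  no index is taken modulo the length \<open>m + 1\<close>. Distinctness of the vertices follows
  from the incidences.\<close>

definition special_cycle ::
  "'a set set \<Rightarrow> nat \<Rightarrow> (nat \<Rightarrow> 'a) \<Rightarrow> (nat \<Rightarrow> 'a set) \<Rightarrow> 'a set \<Rightarrow> bool" where
  "special_cycle H m x K L \<longleftrightarrow> 2 \<le> m \<and> L \<in> H \<and> (\<forall>i<m. K i \<in> H) \<and>
     (\<forall>i<m. \<forall>j\<le>m. x j \<in> K i \<longleftrightarrow> j = i \<or> j = Suc i) \<and>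
     (\<forall>j\<le>m. x j \<in> L \<longleftrightarrow> j = 0 \<or> j = m)"

lemma zigzag_special_cycle:
  assumes N: "2 \<le> N" and c: "\<And>a. a \<le> N \<Longrightarrow> c a \<in> H"
    and pat: "\<And>a b. \<lbrakk>a \<le> N; b \<le> N\<rbrakk> \<Longrightarrow>
       r a \<in> c b \<longleftrightarrow> a = Suc b \<or> b = Suc a \<or> a = 0 \<and> b = 0 \<or> a = N \<and> b = N"
  shows "\<exists>m x K L. special_cycle H m x K L"
proof -
  define A where "A = Suc N div 2"
  have A: "N = 2 * A \<or> Suc N = 2 * A" unfolding A_def by presburger
  \<comment> \<open>Odd rows in decreasing order, followed by the even rows in increasing order.\<close>
  define f where "f i = (if A \<le> i then 2 * (i - A) else 2 * (A - i) - 1)" for i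
  \<comment> \<open>Column \<open>g i\<close> joins rows \<open>f i\<close> and
    \<open>f (Suc i)\<close>: even columns down to 0, then odd columns upwards. The remaining column
    \<open>N\<close> contains rows \<open>N - 1\<close> and \<open>N\<close>, the two ends of the
    walk, and serves as \<open>L\<close>.\<close>
  define g where "g i = (if A \<le> i then Suc (2 * (i - A)) else 2 * (A - i) - 2)" for i
  have f_cases: "A \<le> i \<and> f i + 2 * A = 2 * i \<or> i < A \<and> f i + 2 * i + 1 = 2 * A" for i
    by (auto simp: f_def)
  have g_cases: "A \<le> i \<and> g i + 2 * A = 2 * i + 1 \<or> i < A \<and> g i + 2 * i + 2 = 2 * A" for i
    by (auto simp: g_def)
  have f: "f i \<le> N" if "i \<le> N" for i using that A by (auto simp: f_def)
  have g: "g i \<le> N" if "i < N" for i using that A by (auto simp: g_def)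
  have fg: "f j = Suc (g i) \<or> g i = Suc (f j) \<or> f j = 0 \<and> g i = 0 \<or> f j = N \<and> g i = N
      \<longleftrightarrow> j = i \<or> j = Suc i" if "i < N" "j \<le> N" for i j
    using f_cases[of j] g_cases[of i]
  proof (elim disjE conjE)
    assume "A \<le> j" "f j + 2 * A = 2 * j" "A \<le> i" "g i + 2 * A = 2 * i + 1"
    then show ?thesis using that A by auto
  next
    assume "A \<le> j" "f j + 2 * A = 2 * j" "i < A" "g i + 2 * i + 2 = 2 * A"
    then show ?thesis using that A by auto presburger+
  next
    assume "j < A" "f j + 2 * j + 1 = 2 * A" "A \<le> i" "g i + 2 * A = 2 * i + 1"
    then show ?thesis using that A by auto presburger+
  next
    assume "j < A" "f j + 2 * j + 1 = 2 * A" "i < A" "g i + 2 * i + 2 = 2 * A"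
    then show ?thesis using that A by auto
  qed
  have fN: "f j = Suc N \<or> N = Suc (f j) \<or> f j = 0 \<and> N = 0 \<or> f j = N \<and> N = N
      \<longleftrightarrow> j = 0 \<or> j = N" if "j \<le> N" for j
    using that A N f_cases[of j] by auto
  have "special_cycle H N (\<lambda>j. r (f j)) (\<lambda>i. c (g i)) (c N)"
    unfolding special_cycle_def using N c f g fg fN by (simp add: pat)
  then show ?thesis by blast
qed

theorem no_special_cycle_nest_order:
  assumes "finite V" "finite H" and no: "\<And>m x K L. \<not> special_cycle H m x K L"
  shows "\<exists>vs. distinct vs \<and> set vs = V \<and> nest_order H vs"
proof -
  let ?p = "card V" and ?q = "card H"
  obtain v h where v: "bij_betw v {..<?p} V" and h: "bij_betw h {..<?q} H"
    and lex: "lex_rows ?p ?q (\<lambda>i j. v i \<in> h j)" "lex_rows ?q ?p (\<lambda>j i. v i \<in> h j)"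
    using doubly_lexical_enumeration[OF assms(1,2), of "(\<in>)"] by blast
  \<comment> \<open>Of two cliques through \<open>v i\<close>, the earlier one is thus contained in
    the later one as far as vertices after \<open>v i\<close> are concerned; this is the chain
    condition when vertices are deleted in increasing order.\<close>
  have gamma: "v i' \<in> h j'"
    if a: "i < i'" "i' < ?p" "j < j'" "j' < ?q" "v i \<in> h j" "v i \<in> h j'" "v i' \<in> h j" for i i' j j'
  proof (rule ccontr)
    assume "v i' \<notin> h j'"
    then obtain N r c where z: "2 \<le> N" "\<And>a. a \<le> N \<Longrightarrow> r a < ?p" "\<And>a. a \<le> N \<Longrightarrow> c a < ?q"
      "\<And>a b. \<lbrakk>a \<le> N; b \<le> N\<rbrakk> \<Longrightarrow>
       v (r a) \<in> h (c b) \<longleftrightarrow> a = Suc b \<or> b = Suc a \<or> a = 0 \<and> b = 0 \<or> a = N \<and> b = N"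
      using gamma_closed_zigzag[OF lex a] by blast
    have "h (c a) \<in> H" if "a \<le> N" for a
      using bij_betwE[OF h] z(3)[OF that] by auto
    then show False
      using zigzag_special_cycle[of N "\<lambda>a. h (c a)" H "\<lambda>a. v (r a)"] z(1,4) no by blast
  qed
  have "nest_order H (map v [n..<?p])" if "n \<le> ?p" for n
    using that
  proof (induction rule: inc_induct)
    case (step n)
    have "C \<inter> v ` {Suc n..<?p} \<subseteq> D \<or> D \<inter> v ` {Suc n..<?p} \<subseteq> C"
      if CD: "C \<in> H" "D \<in> H" "v n \<in> C" "v n \<in> D" for C D
    proof -
      have "h ` {..<?q} = H" using h by (simp add: bij_betw_def)
      then have "C \<in> h ` {..<?q}" "D \<in> h ` {..<?q}" using CD by simp_all
      then obtain j j' where j: "j < ?q" "C = h j" "j' < ?q" "D = h j'" by auto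
      show ?thesis
      proof (cases j j' rule: linorder_cases)
        case less
        have "v i \<in> D" if "v i \<in> C" "Suc n \<le> i" "i < ?p" for i
          using gamma[of n i j j'] less j CD that by simp
        then have "C \<inter> v ` {Suc n..<?p} \<subseteq> D" by auto
        then show ?thesis ..
      next
        case equal
        then show ?thesis using j by auto
      next
        case greater
        have "v i \<in> C" if "v i \<in> D" "Suc n \<le> i" "i < ?p" for i
          using gamma[of n i j' j] greater j CD that by simp
        then have "D \<inter> v ` {Suc n..<?p} \<subseteq> C" by auto
        then show ?thesis ..
      qed
    qed
    then show ?case using step by (simp add: upt_conv_Cons)
  qed simp
  from this[of 0] have "nest_order H (map v [0..<?p])" by simp
  moreover have "distinct (map v [0..<?p])" "set (map v [0..<?p]) = V"
    using v by (auto simp: bij_betw_def distinct_map atLeast0LessThan)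
  ultimately show ?thesis by blast
qed

section \<open>Maximal cliques of strongly chordal graphs\<close>

lemma simple_graph_edgeD:
  assumes "simple_graph V E" "{x, y} \<in> E"
  shows "x \<in> V" "y \<in> V" "x \<noteq> y"
proof -
  obtain u v where "u \<in> V" "v \<in> V" "u \<noteq> v" "{x, y} = {u, v}"
    using assms unfolding simple_graph_def by blast
  then show "x \<in> V" "y \<in> V" "x \<noteq> y" by (auto simp: doubleton_eq_iff)
qed

text \<open>Induced subgraphs arise here as embeddings \<open>g\<close> of the pattern into the
  graph, whereas the definition asks for a map in the other direction; \<open>inv_into\<close>
  reverses it.\<close>

lemma contains_inducedI:
  assumes inj: "inj_on g V'" and sub: "g ` V' \<subseteq> V"
    and adj: "\<And>a b. a \<in> V' \<Longrightarrow> b \<in> V' \<Longrightarrow> {g a, g b} \<in> E \<longleftrightarrow> {a, b} \<in> E'"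
  shows "contains_induced V E V' E'"
  unfolding contains_induced_def graph_iso_def
proof (intro exI conjI ballI)
  show "bij_betw (inv_into V' g) (g ` V') V'"
    using inj by (simp add: bij_betw_inv_into inj_on_imp_bij_betw)
  fix x y assume "x \<in> g ` V'" "y \<in> g ` V'"
  then obtain a b where "a \<in> V'" "b \<in> V'" "x = g a" "y = g b" by auto
  then show "{x, y} \<in> induced_edges E (g ` V') \<longleftrightarrow> {inv_into V' g x, inv_into V' g y} \<in> E'"
    using inj adj by (simp add: induced_edges_def)
qed (rule sub)

lemma doubleton_mem_cycle_edges:
  "{i, j} \<in> cycle_edges n \<longleftrightarrow> i < n \<and> j = Suc i mod n \<or> j < n \<and> i = Suc j mod n"
  unfolding cycle_edges_def by (auto simp: doubleton_eq_iff)

lemma chordal_no_induced_cycle: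
  assumes "chordal V E" "3 < n" "inj_on x {..<n}" "x ` {..<n} \<subseteq> V"
  shows "\<exists>i<n. \<exists>j<n. ({x i, x j} \<in> E) \<noteq> (j = Suc i mod n \<or> i = Suc j mod n)"
proof (rule ccontr)
  assume "\<not> ?thesis"
  then have "contains_induced V E (cycle_verts n) (cycle_edges n)"
    using assms(3,4) unfolding cycle_verts_def
    by (intro contains_inducedI[of x]) (auto simp: doubleton_mem_cycle_edges)
  then show False using assms(1,2) by (auto simp: chordal_def)
qed

text \<open>The form of chordality used to find private vertices of cliques and to show that the
  outer vertices of a sun are independent.\<close>

lemma chordal_four_cycle:
  assumes simple: "simple_graph V E" and chordal: "chordal V E"
    and e: "{a, b} \<in> E" "{b, c} \<in> E" "{c, d} \<in> E" "{d, a} \<in> E" and ne: "a \<noteq> c" "b \<noteq> d"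
  shows "{a, c} \<in> E \<or> {b, d} \<in> E"
proof (rule ccontr)
  assume no: "\<not> ?thesis"
  note D = simple_graph_edgeD[OF simple]
  have loop: "{z, z} \<notin> E" for z using D(3) by blast
  have e': "{b, a} \<in> E" "{c, b} \<in> E" "{d, c} \<in> E" "{a, d} \<in> E" using e by (simp_all add: insert_commute)
  have no': "{a, c} \<notin> E" "{b, d} \<notin> E" "{c, a} \<notin> E" "{d, b} \<notin> E"
    using no by (simp_all add: insert_commute)
  let ?x = "(!) [a, b, c, d]"
  have four: "i = 0 \<or> i = 1 \<or> i = 2 \<or> i = 3" if "i < 4" for i :: nat using that by auto
  have neq: "a \<noteq> b" "b \<noteq> c" "c \<noteq> d" "d \<noteq> a" using e D(3) by blast+
  have "distinct [a, b, c, d]" using neq ne by auto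
  then have "inj_on ?x {..<4}" by (intro inj_on_nth) auto
  moreover have "?x ` {..<4} \<subseteq> V"
  proof
    fix z assume "z \<in> ?x ` {..<4}"
    then obtain i where "i < 4" "z = ?x i" by auto
    then have "z \<in> {a, b, c, d}" using four[OF \<open>i < 4\<close>] by auto
    then show "z \<in> V" using D(1)[OF e(1)] D(1)[OF e(2)] D(1)[OF e(3)] D(1)[OF e(4)] by auto
  qed
  ultimately obtain i j where "i < 4" "j < 4"
    and ij: "({?x i, ?x j} \<in> E) \<noteq> (j = Suc i mod 4 \<or> i = Suc j mod 4)"
    using chordal_no_induced_cycle[OF chordal, of 4 ?x] by auto
  then show False
    using four[OF \<open>i < 4\<close>] four[OF \<open>j < 4\<close>] e e' no' loop[of a] loop[of b] loop[of c] loop[of d]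
    by (elim disjE) simp_all
qed

text \<open>Maximality is tested by single vertices: a clique properly containing \<open>Q\<close>
  has a vertex outside \<open>Q\<close> adjacent to all of \<open>Q\<close>.\<close>

definition max_cliques :: "'a set \<Rightarrow> 'a set set \<Rightarrow> 'a set set" where
  "max_cliques V E = {Q. Q \<subseteq> V \<and> (\<forall>x\<in>Q. \<forall>y\<in>Q. x \<noteq> y \<longrightarrow> {x, y} \<in> E) \<and>
     (\<forall>z\<in>V. (\<forall>x\<in>Q. x \<noteq> z \<longrightarrow> {x, z} \<in> E) \<longrightarrow> z \<in> Q)}"

lemma max_cliquesD:
  assumes "Q \<in> max_cliques V E"
  shows "Q \<subseteq> V" "\<And>x y. x \<in> Q \<Longrightarrow> y \<in> Q \<Longrightarrow> x \<noteq> y \<Longrightarrow> {x, y} \<in> E"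
    "\<And>z. z \<in> V \<Longrightarrow> (\<And>x. x \<in> Q \<Longrightarrow> x \<noteq> z \<Longrightarrow> {x, z} \<in> E) \<Longrightarrow> z \<in> Q"
proof -
  have Q: "Q \<subseteq> V" "\<forall>x\<in>Q. \<forall>y\<in>Q. x \<noteq> y \<longrightarrow> {x, y} \<in> E"
    "\<forall>z\<in>V. (\<forall>x\<in>Q. x \<noteq> z \<longrightarrow> {x, z} \<in> E) \<longrightarrow> z \<in> Q"
    using assms unfolding max_cliques_def mem_Collect_eq by blast+
  show "Q \<subseteq> V" by (rule Q)
  show "{x, y} \<in> E" if "x \<in> Q" "y \<in> Q" "x \<noteq> y" for x y using Q(2) that by blast
  show "z \<in> Q" if "z \<in> V" "\<And>x. x \<in> Q \<Longrightarrow> x \<noteq> z \<Longrightarrow> {x, z} \<in> E" for z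
    using bspec[OF Q(3) that(1)] that(2) by simp
qed

lemma clique_subset_max_clique:
  assumes "finite V" "C \<subseteq> V" "\<And>x y. x \<in> C \<Longrightarrow> y \<in> C \<Longrightarrow> x \<noteq> y \<Longrightarrow> {x, y} \<in> E"
  obtains Q where "Q \<in> max_cliques V E" "C \<subseteq> Q"
proof -
  let ?A = "{Q \<in> Pow V. \<forall>x\<in>Q. \<forall>y\<in>Q. x \<noteq> y \<longrightarrow> {x, y} \<in> E}"
  have "finite ?A" using assms(1) by simp
  moreover have "C \<in> ?A" using assms by auto
  ultimately obtain Q where Q: "Q \<in> ?A" "C \<subseteq> Q" "\<forall>B\<in>?A. Q \<subseteq> B \<longrightarrow> Q = B"
    using finite_has_maximal2[of ?A C] by auto
  have "z \<in> Q" if z: "z \<in> V" "\<forall>x\<in>Q. x \<noteq> z \<longrightarrow> {x, z} \<in> E" for z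
  proof -
    have "{z, x} \<in> E" if "x \<in> Q" "x \<noteq> z" for x using z(2) that by (simp add: insert_commute)
    then have "insert z Q \<in> ?A" using Q(1) z by auto
    then have "Q = insert z Q" using bspec[OF Q(3)] by blast
    then show ?thesis by blast
  qed
  then have "Q \<in> max_cliques V E" using Q(1) unfolding max_cliques_def by simp
  then show thesis using that Q(2) by blast
qed

text \<open>The neighbourhoods in \<open>X\<close> of the vertices of \<open>Q\<close> form a chain, since incomparable ones would
  give an induced four-cycle; by maximality of \<open>Q\<close> the smallest of them lies in \<open>Q\<close>.\<close>

lemma max_clique_private_vertex:
  assumes simple: "simple_graph V E" and chordal: "chordal V E" and Q: "Q \<in> max_cliques V E"
    and X: "finite X" "X \<subseteq> V" "X \<noteq> {}"
    and cliqueX: "\<And>x y. x \<in> X \<Longrightarrow> y \<in> X \<Longrightarrow> x \<noteq> y \<Longrightarrow> {x, y} \<in> E"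
  obtains w where "w \<in> Q" "\<And>y. y \<in> X \<Longrightarrow> y = w \<or> {y, w} \<in> E \<Longrightarrow> y \<in> Q"
proof -
  define N where "N w = {y \<in> X. y = w \<or> {y, w} \<in> E}" for w
  have "Q \<noteq> {}" using max_cliquesD(3)[OF Q] X by auto
  then obtain w where w: "w \<in> Q" "\<And>u. u \<in> Q \<Longrightarrow> card (N w) \<le> card (N u)"
    using ex_has_least_nat[of "\<lambda>w. w \<in> Q" _ "\<lambda>w. card (N w)"] by blast
  have "y \<in> Q" if y: "y \<in> X" "y = w \<or> {y, w} \<in> E" for y
  proof (rule ccontr)
    assume yQ: "y \<notin> Q"
    have "y \<in> V" using y X by auto
    then obtain u where u: "u \<in> Q" "u \<noteq> y" "{u, y} \<notin> E" using max_cliquesD(3)[OF Q] yQ by blast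
    have yu: "y \<notin> N u" using u by (auto simp: N_def insert_commute)
    have yw: "{y, w} \<in> E" using y yQ w by auto
    have "y \<in> N w" using y by (auto simp: N_def)
    moreover have "finite (N w)" using X(1) by (simp add: N_def)
    \<comment> \<open>An inclusion would be proper because of \<open>y\<close>, against the
      minimality of \<open>card (N w)\<close>.\<close>
    ultimately have "\<not> N u \<subseteq> N w"
      using psubset_card_mono[of "N w" "N u"] w(2)[OF u(1)] yu by auto
    then obtain y' where y': "y' \<in> N u" "y' \<notin> N w" by blast
    have y'X: "y' \<in> X" using y' by (simp add: N_def)
    have "y \<noteq> y'" using y' yu by auto
    have "y' \<noteq> u" using u cliqueX[OF _ y(1), of u] y'X by auto
    then have "{y', u} \<in> E" using y' by (simp add: N_def)
    have "u \<noteq> w" using u yw by (auto simp: insert_commute)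
    then have "{w, u} \<in> E" using max_cliquesD(2)[OF Q] u w by blast
    have "y' \<noteq> w" "{y', w} \<notin> E" using y' y'X by (auto simp: N_def)
    have "{y, w} \<in> E \<and> {w, u} \<in> E \<and> {u, y'} \<in> E \<and> {y', y} \<in> E"
      using yw \<open>{w, u} \<in> E\<close> \<open>{y', u} \<in> E\<close> cliqueX[OF y'X y(1)] \<open>y \<noteq> y'\<close>
      by (auto simp: insert_commute)
    then have "{y, u} \<in> E \<or> {w, y'} \<in> E"
      using u(2) \<open>y' \<noteq> w\<close> by (intro chordal_four_cycle[OF simple chordal]) auto
    then show False using u(3) \<open>{y', w} \<notin> E\<close> by (auto simp: insert_commute)
  qed
  then show thesis using that w(1) by blast
qed

section \<open>Shortest special cycles and suns\<close>

lemma add_mod_cancel_nat: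
  fixes a i j n :: nat
  assumes "(a + i) mod n = (a + j) mod n" "i < n" "j < n"
  shows "i = j"
  using assms
proof (induction i j rule: linorder_wlog)
  case (le i j)
  then have "n dvd (a + j) - (a + i)" by (subst mod_eq_dvd_iff_nat[symmetric]) auto
  then have "n dvd j - i" by simp
  then show ?case using le by (auto dest: dvd_imp_le)
qed auto

text \<open>Equal vertices lie in the same cliques. For \<open>x i = x j\<close> with
  \<open>i < j\<close>, the clique \<open>K i\<close> leaves only \<open>j = Suc i\<close>, and the
  preceding clique, which is \<open>L\<close> for \<open>i = 0\<close>, separates these two.\<close>

lemma special_cycle_inj:
  assumes "special_cycle H m x K L"
  shows "inj_on x {..m}"
proof -
  have False if "i < j" "j \<le> m" "x i = x j" for i j
  proof -
    have m: "2 \<le> m" and K: "\<And>i j. i < m \<Longrightarrow> j \<le> m \<Longrightarrow> x j \<in> K i \<longleftrightarrow> j = i \<or> j = Suc i"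
      and L: "\<And>j. j \<le> m \<Longrightarrow> x j \<in> L \<longleftrightarrow> j = 0 \<or> j = m"
      using assms by (auto simp: special_cycle_def)
    have "j = Suc i" using K[of i i] K[of i j] that by auto
    show False
    proof (cases i)
      case 0
      then show ?thesis using L[of i] L[of j] \<open>j = Suc i\<close> that m by auto
    next
      case (Suc l)
      then show ?thesis using K[of l i] K[of l j] that \<open>j = Suc i\<close> by auto
    qed
  qed
  then show ?thesis by (intro linorder_inj_onI) auto
qed

text \<open>Without a chord, the cycle through the vertices \<open>x i\<close> is induced, so it is
  a triangle by chordality. With a chord, a maximal clique \<open>Q\<close> containing the chord
  must contain all \<open>x i\<close>, since otherwise \<open>Q\<close> would cut off a shorter
  special cycle.\<close>

lemma shortest_special_cycle_clique:
  assumes simple: "simple_graph V E" and "finite V" and chordal: "chordal V E"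
    and spec: "special_cycle (max_cliques V E) m x K L"
    and minimal: "\<And>m' x' K' L'. special_cycle (max_cliques V E) m' x' K' L' \<Longrightarrow> m \<le> m'"
    and ij: "i \<le> m" "j \<le> m" "i \<noteq> j"
  shows "{x i, x j} \<in> E"
proof -
  let ?H = "max_cliques V E"
  define n where "n = Suc m"
  \<comment> \<open>Periodic continuation of the vertices and cliques, so that an arc crossing the
    closing clique \<open>L\<close> is still an interval of indices.\<close>
  define X where "X i = x (i mod n)" for i
  define C where "C i = (if i mod n < m then K (i mod n) else L)" for i
  have m: "2 \<le> m" and KH: "\<And>i. i < m \<Longrightarrow> K i \<in> ?H" and LH: "L \<in> ?H"
    and K: "\<And>i j. i < m \<Longrightarrow> j \<le> m \<Longrightarrow> x j \<in> K i \<longleftrightarrow> j = i \<or> j = Suc i"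
    and L: "\<And>j. j \<le> m \<Longrightarrow> x j \<in> L \<longleftrightarrow> j = 0 \<or> j = m"
    using spec by (auto simp: special_cycle_def)
  have modn: "l mod n \<le> m" for l by (simp add: n_def less_Suc_eq_le[symmetric] del: less_Suc_eq_le)
  have modn_id: "l mod n = l" if "l \<le> m" for l using that by (simp add: n_def)
  then have Xsmall: "X l = x l" if "l \<le> m" for l using that by (simp add: X_def)
  have CH: "C l \<in> ?H" for l using KH LH by (simp add: C_def)
  have inc: "X j \<in> C i \<longleftrightarrow> j mod n = i mod n \<or> j mod n = Suc i mod n" for i j
  proof (cases "i mod n < m")
    case True
    then have "Suc i mod n = Suc (i mod n)" by (simp add: mod_Suc n_def)
    then show ?thesis using True K modn by (simp add: X_def C_def)
  next
    case False
    then have "i mod n = m" using modn[of i] by simp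
    then have "Suc i mod n = 0" by (simp add: mod_Suc n_def)
    then show ?thesis using False \<open>i mod n = m\<close> L modn by (auto simp: X_def C_def)
  qed
  have XV: "X l \<in> V" for l using inc[of l l] max_cliquesD(1)[OF CH[of l]] by auto
  have inj: "inj_on x {..m}" using special_cycle_inj[OF spec] .
  have consecutive: "{X l, X (Suc l)} \<in> E" for l
  proof -
    have "l mod n \<noteq> Suc l mod n" using m by (auto simp: mod_Suc n_def)
    then have "X l \<noteq> X (Suc l)" using inj modn by (simp add: X_def inj_on_eq_iff)
    then show ?thesis using max_cliquesD(2)[OF CH[of l]] inc by simp
  qed
  show ?thesis
  proof (cases "\<exists>s\<le>m. \<exists>t\<le>m. {x s, x t} \<in> E \<and> t \<noteq> Suc s mod n \<and> s \<noteq> Suc t mod n")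
    case False
    have iff: "{x s, x t} \<in> E \<longleftrightarrow> t = Suc s mod n \<or> s = Suc t mod n" if "s \<le> m" "t \<le> m" for s t
    proof
      have XS: "X (Suc l) = x (Suc l mod n)" for l by (simp add: X_def)
      assume "t = Suc s mod n \<or> s = Suc t mod n"
      then show "{x s, x t} \<in> E"
        using consecutive[of s] consecutive[of t] that by (auto simp: XS Xsmall insert_commute)
    qed (use False that in blast)
    show ?thesis
    proof (cases "3 < n")
      case True
      have "{..<n} = {..m}" by (auto simp: n_def)
      moreover have "x ` {..m} \<subseteq> V" using XV Xsmall by (metis atMost_iff image_subsetI)
      ultimately show ?thesis
        using chordal_no_induced_cycle[OF chordal True, of x] inj iff by (auto simp: n_def less_Suc_eq_le)
    next
      case False
      then have "n = 3" "m = 2" using m by (auto simp: n_def)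
      moreover from this have "i = 0 \<or> i = 1 \<or> i = 2" "j = 0 \<or> j = 1 \<or> j = 2"
        using ij by auto
      ultimately have "j = Suc i mod n \<or> i = Suc j mod n"
        using ij(3) by (elim disjE) simp_all
      then show ?thesis using iff ij by blast
    qed
  next
    case True
    then obtain s t where st: "s \<le> m" "t \<le> m" "{x s, x t} \<in> E" "t \<noteq> Suc s mod n" "s \<noteq> Suc t mod n"
      by blast
    have "x s \<noteq> x t" "x s \<in> V" "x t \<in> V" using simple_graph_edgeD[OF simple st(3)] by auto
    moreover have "{x t, x s} \<in> E" using st(3) by (simp add: insert_commute)
    ultimately obtain Q where "Q \<in> ?H" "{x s, x t} \<subseteq> Q"
      using clique_subset_max_clique[OF \<open>finite V\<close>, of "{x s, x t}" E] st(3) by auto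
    then have Q: "Q \<in> ?H" "x s \<in> Q" "x t \<in> Q" by auto
    have "x k \<in> Q" if "k \<le> m" for k
    proof (rule ccontr)
      assume "x k \<notin> Q"
      \<comment> \<open>The arc around \<open>k\<close> cut out by two consecutive elements of \<open>Q\<close> is closed up by \<open>Q\<close> to a
        shorter special cycle.\<close>
      define k' where "k' = k + n"
      have k': "X k' \<notin> Q" using \<open>x k \<notin> Q\<close> that by (simp add: k'_def X_def modn_id)
      have XQ: "X (s + l * n) \<in> Q" for l using Q st by (simp add: X_def modn_id)
      \<comment> \<open>The indices of \<open>Q\<close> nearest to \<open>k'\<close> on either side.
        The shift of \<open>k\<close> by \<open>n\<close> ensures that both exist: \<open>s\<close>
        lies before \<open>k'\<close> and \<open>s + 2 * n\<close> after it.\<close>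
      define a where "a = Max {l. l < k' \<and> X l \<in> Q}"
      define b where "b = (LEAST l. k' < l \<and> X l \<in> Q)"
      have "s \<in> {l. l < k' \<and> X l \<in> Q}" using XQ[of 0] st by (simp add: k'_def n_def)
      then have "a \<in> {l. l < k' \<and> X l \<in> Q}" unfolding a_def by (intro Max_in) auto
      then have a: "a < k'" "X a \<in> Q" by auto
      have amax: "l \<le> a" if "l < k'" "X l \<in> Q" for l
        unfolding a_def using that by (intro Max_ge) auto
      have "k' < s + 2 * n \<and> X (s + 2 * n) \<in> Q" using XQ[of 2] that by (simp add: k'_def n_def)
      then have b: "k' < b" "X b \<in> Q" and bmin: "\<And>l. k' < l \<Longrightarrow> X l \<in> Q \<Longrightarrow> b \<le> l"
        unfolding b_def by (metis (mono_tags, lifting) LeastI Least_le)+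
      have gap: "X l \<notin> Q" if "a < l" "l < b" for l
        using amax[of l] bmin[of l] k' that by (cases l k' rule: linorder_cases) auto
      have "b - a < m"
      proof (rule ccontr)
        assume long: "\<not> b - a < m"
        \<comment> \<open>An arc of at least \<open>m\<close> steps would leave \<open>Q\<close>
          only the vertices at \<open>a\<close> and \<open>a + m\<close>. These are consecutive
          modulo \<open>n\<close>, whereas \<open>s\<close> and \<open>t\<close> are not.\<close>
        have ends: "u = a mod n \<or> u = (a + m) mod n" if u: "u \<le> m" "x u \<in> Q" for u
        proof -
          \<comment> \<open>The offset of \<open>u\<close> from \<open>a\<close> modulo
            \<open>n\<close>; adding \<open>n * a\<close> avoids truncated subtraction.\<close>
          define d where "d = (u + n * a - a) mod n"
          have "a \<le> n * a" by (simp add: n_def)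
          then have "a + (u + n * a - a) = u + n * a" by linarith
          then have "(a + d) mod n = (u + n * a) mod n"
            unfolding d_def mod_add_right_eq by (simp only:)
          then have d: "(a + d) mod n = u" using u by (simp add: modn_id)
          then have "X (a + d) \<in> Q" using u by (simp add: X_def)
          moreover have "d \<le> m" using modn by (simp add: d_def)
          ultimately have "d = 0 \<or> d = m" using gap[of "a + d"] long by force
          then show ?thesis using d by auto
        qed
        have "Suc ((a + m) mod n) mod n = a mod n"
          by (simp add: n_def mod_Suc_eq flip: add_Suc_right)
        moreover have "s \<noteq> t" using \<open>x s \<noteq> x t\<close> by auto
        ultimately show False using ends[of s] ends[of t] Q st by auto
      qed
      have "special_cycle ?H (b - a) (\<lambda>l. X (a + l)) (\<lambda>l. C (a + l)) Q"
        unfolding special_cycle_def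
      proof (intro conjI allI impI)
        show "2 \<le> b - a" using a b by simp
        show "X (a + j) \<in> C (a + i) \<longleftrightarrow> j = i \<or> j = Suc i" if "i < b - a" "j \<le> b - a" for i j
        proof -
          have "i < n" "Suc i < n" "j < n" using that \<open>b - a < m\<close> by (auto simp: n_def)
          then show ?thesis unfolding inc
            using add_mod_cancel_nat[of a j n i] add_mod_cancel_nat[of a j n "Suc i"] by auto
        qed
        show "X (a + j) \<in> Q \<longleftrightarrow> j = 0 \<or> j = b - a" if "j \<le> b - a" for j
        proof -
          have "X (a + j) \<notin> Q" if "0 < j" "j < b - a" using gap[of "a + j"] that by simp
          moreover have "a + (b - a) = b" using a b by simp
          ultimately show ?thesis using a(2) b(2) \<open>j \<le> b - a\<close> by (metis add_0_right le_neq_implies_less neq0_conv)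
        qed
      qed (use Q CH in auto)
      then show False using minimal \<open>b - a < m\<close> by (meson leD)
    qed
    moreover have "x i \<noteq> x j" using inj ij by (simp add: inj_on_eq_iff)
    ultimately show ?thesis using max_cliquesD(2)[OF Q(1)] ij by blast
  qed
qed

lemma doubleton_mem_sun_edges:
  "{Inl i, Inl j} \<in> sun_edges n \<longleftrightarrow> i \<noteq> j \<and> i < n \<and> j < n"
  "{Inr i, Inl j} \<in> sun_edges n \<longleftrightarrow> i < n \<and> (j = i \<or> j = Suc i mod n)"
  "{Inl j, Inr i} \<in> sun_edges n \<longleftrightarrow> i < n \<and> (j = i \<or> j = Suc i mod n)"
  "{Inr i, Inr j} \<notin> sun_edges n"
proof -
  have "{Inl i, Inl j} = {Inl j, Inl i :: nat + nat}" by blast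
  then show "{Inl i, Inl j} \<in> sun_edges n \<longleftrightarrow> i \<noteq> j \<and> i < n \<and> j < n"
    unfolding sun_edges_def by (cases i j rule: linorder_cases) (auto simp: doubleton_eq_iff)
  show "{Inr i, Inl j} \<in> sun_edges n \<longleftrightarrow> i < n \<and> (j = i \<or> j = Suc i mod n)"
    unfolding sun_edges_def by (auto simp: doubleton_eq_iff)
  then show "{Inl j, Inr i} \<in> sun_edges n \<longleftrightarrow> i < n \<and> (j = i \<or> j = Suc i mod n)"
    by (simp add: insert_commute)
  show "{Inr i, Inr j} \<notin> sun_edges n"
    unfolding sun_edges_def by (auto simp: doubleton_eq_iff)
qed

text \<open>The \<open>x i\<close> form the central clique. Each maximal clique \<open>C i\<close>
  of the cycle contributes an outer vertex \<open>W i\<close> whose only neighbours among the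
  \<open>x j\<close> are the two in \<open>C i\<close>, by
  \<open>max_clique_private_vertex\<close>.\<close>

lemma special_cycle_clique_sun:
  assumes simple: "simple_graph V E" and chordal: "chordal V E"
    and spec: "special_cycle (max_cliques V E) m x K L"
    and clique: "\<And>i j. \<lbrakk>i \<le> m; j \<le> m; i \<noteq> j\<rbrakk> \<Longrightarrow> {x i, x j} \<in> E"
  shows "contains_induced V E (sun_verts (Suc m)) (sun_edges (Suc m))"
proof -
  let ?H = "max_cliques V E"
  define n where "n = Suc m"
  define C where "C i = (if i < m then K i else L)" for i
  have m: "2 \<le> m" and CH: "\<And>i. C i \<in> ?H"
    using spec by (auto simp: special_cycle_def C_def)
  have inc: "x j \<in> C i \<longleftrightarrow> j = i \<or> j = Suc i mod n" if "i < n" "j < n" for i j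
  proof (cases "i < m")
    case True
    then have "Suc i mod n = Suc i" by (simp add: n_def)
    then show ?thesis using that spec True by (simp add: special_cycle_def C_def n_def)
  next
    case False
    then have "i = m" using that by (simp add: n_def)
    then have "Suc i mod n = 0" by (simp add: n_def)
    then show ?thesis using that spec \<open>i = m\<close> by (auto simp: special_cycle_def C_def n_def)
  qed
  have inj: "inj_on x {..<n}"
    using special_cycle_inj[OF spec] by (simp add: n_def lessThan_Suc_atMost)
  have xV: "x j \<in> V" if "j < n" for j using inc[of j j] max_cliquesD(1)[OF CH[of j]] that by auto
  have "\<exists>w. w \<in> C i \<and> (\<forall>j<n. x j = w \<or> {x j, w} \<in> E \<longrightarrow> x j \<in> C i)" for i
  proof (rule max_clique_private_vertex[OF simple chordal CH[of i], of "x ` {..<n}"])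
    fix w assume w: "w \<in> C i" "\<And>y. y \<in> x ` {..<n} \<Longrightarrow> y = w \<or> {y, w} \<in> E \<Longrightarrow> y \<in> C i"
    show ?thesis using w by (intro exI[of _ w]) auto
  next
    fix y z assume "y \<in> x ` {..<n}" "z \<in> x ` {..<n}" "y \<noteq> z"
    then obtain k l where "k < n" "l < n" "y = x k" "z = x l" "k \<noteq> l" by auto
    then show "{y, z} \<in> E" using clique by (simp add: n_def)
  qed (use xV in \<open>auto simp: n_def\<close>)
  then obtain W where WC: "\<And>i. W i \<in> C i"
    and W: "\<And>i j. j < n \<Longrightarrow> x j = W i \<or> {x j, W i} \<in> E \<Longrightarrow> x j \<in> C i"
    by metis
  have WV: "W i \<in> V" for i using WC max_cliquesD(1)[OF CH] by blast
  have third: "\<exists>l<n. l \<noteq> i \<and> l \<noteq> Suc i mod n" if "i < n" for i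
  proof -
    have "\<not> {..<n} \<subseteq> {i, Suc i mod n}"
    proof
      assume "{..<n} \<subseteq> {i, Suc i mod n}"
      then have "card {..<n} \<le> card {i, Suc i mod n}" by (intro card_mono) auto
      also have "\<dots> \<le> 2" by (simp add: card_insert_if)
      finally show False using m by (simp add: n_def)
    qed
    then show ?thesis by auto
  qed
  have Wx: "W i \<noteq> x j" if ij: "i < n" "j < n" for i j
  proof
    assume "W i = x j"
    obtain l where l: "l < n" "l \<noteq> i" "l \<noteq> Suc i mod n" using third ij by blast
    \<comment> \<open>If \<open>W i\<close> were one of the \<open>x j\<close>, it would equal or be
      adjacent to every \<open>x l\<close>, so all of them would lie in \<open>C i\<close>, which
      misses some \<open>x l\<close> because \<open>n\<close> is at least three.\<close>
    have "x l = W i \<or> {x l, W i} \<in> E"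
      using \<open>W i = x j\<close> clique[of l j] l ij by (cases "l = j") (auto simp: n_def)
    then show False using W[OF l(1)] inc[OF ij(1) l(1)] l by blast
  qed
  have Wadj: "{x j, W i} \<in> E \<longleftrightarrow> j = i \<or> j = Suc i mod n" if "i < n" "j < n" for i j
  proof
    assume "{x j, W i} \<in> E"
    then show "j = i \<or> j = Suc i mod n" using W inc that by blast
  next
    assume "j = i \<or> j = Suc i mod n"
    then have "x j \<in> C i" using inc that by blast
    then show "{x j, W i} \<in> E" using max_cliquesD(2)[OF CH _ WC] Wx[OF that] by metis
  qed
  \<comment> \<open>Two different edges of a cycle of length at least three have different pairs of
    ends, so each has an end outside the other.\<close>
  have apart: "\<exists>l<n. (l = i \<or> l = Suc i mod n) \<and> \<not> (l = j \<or> l = Suc j mod n)"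
    if "i < n" "j < n" "i \<noteq> j" for i j
  proof (rule ccontr)
    assume "\<not> ?thesis"
    moreover have "Suc i mod n < n" by (simp add: n_def)
    ultimately have "i = Suc j mod n" "Suc i mod n = j \<or> Suc i mod n = Suc j mod n"
      using that by blast+
    then show False using that m by (auto simp: mod_Suc n_def split: if_splits)
  qed
  have Winj: "W i \<noteq> W j" if "i < n" "j < n" "i \<noteq> j" for i j
    using apart[OF that] Wadj that by metis
  have WW: "{W i, W j} \<notin> E" if ij: "i < n" "j < n" for i j
  proof
    assume e: "{W i, W j} \<in> E"
    then have "i \<noteq> j" using simple_graph_edgeD(3)[OF simple] by blast
    obtain k where k: "k < n" "{x k, W i} \<in> E" "{x k, W j} \<notin> E"
      using apart[OF ij \<open>i \<noteq> j\<close>] Wadj ij by metis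
    obtain l where l: "l < n" "{x l, W j} \<in> E" "{x l, W i} \<notin> E"
      using apart[OF ij(2,1)] \<open>i \<noteq> j\<close> Wadj ij by metis
    have "k \<noteq> l" using k l by auto
    \<comment> \<open>Adjacent outer vertices would give the four-cycle \<open>W i\<close>,
      \<open>x k\<close>, \<open>x l\<close>, \<open>W j\<close>, both of whose diagonals are
      missing.\<close>
    then have "{W i, x l} \<in> E \<or> {x k, W j} \<in> E"
      using e k l clique[of k l] Wx[OF ij(2) k(1)] Wx[OF ij(1) l(1)]
      by (intro chordal_four_cycle[OF simple chordal]) (auto simp: insert_commute n_def)
    then show False using k l by (simp add: insert_commute)
  qed
  have loop: "{z, z} \<notin> E" for z using simple_graph_edgeD(3)[OF simple] by blast
  have "contains_induced V E (sun_verts n) (sun_edges n)"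
  proof (rule contains_inducedI[of "case_sum x W"])
    show "inj_on (case_sum x W) (sun_verts n)"
      unfolding sun_verts_def
    proof (rule inj_onI)
      fix a b assume "a \<in> Inl ` {..<n} \<union> Inr ` {..<n}" "b \<in> Inl ` {..<n} \<union> Inr ` {..<n}"
        and eq: "case_sum x W a = case_sum x W b"
      then consider i j where "a = Inl i" "b = Inl j" "i < n" "j < n"
        | i j where "a = Inr i" "b = Inl j" "i < n" "j < n"
        | i j where "a = Inl i" "b = Inr j" "i < n" "j < n"
        | i j where "a = Inr i" "b = Inr j" "i < n" "j < n" by blast
      then show "a = b"
      proof cases
        case 1
        then show ?thesis using eq inj by (auto simp: inj_on_def)
      next
        case 2
        then show ?thesis using eq Wx by auto
      next
        case 3
        then show ?thesis using eq Wx[of j i] by auto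
      next
        case 4
        then show ?thesis using eq Winj[of i j] by auto
      qed
    qed
    show "case_sum x W ` sun_verts n \<subseteq> V" using xV WV by (auto simp: sun_verts_def)
    fix a b assume "a \<in> sun_verts n" "b \<in> sun_verts n"
    then consider i j where "a = Inl i" "b = Inl j" "i < n" "j < n"
      | i j where "a = Inr i" "b = Inl j" "i < n" "j < n"
      | i j where "a = Inl i" "b = Inr j" "i < n" "j < n"
      | i j where "a = Inr i" "b = Inr j" "i < n" "j < n" unfolding sun_verts_def by blast
    then show "{case_sum x W a, case_sum x W b} \<in> E \<longleftrightarrow> {a, b} \<in> sun_edges n"
    proof cases
      case 1
      then show ?thesis using clique[of i j] loop doubleton_mem_sun_edges(1)[of i j n]
        by (cases "i = j") (auto simp: n_def)
    next
      case 2
      then show ?thesis using Wadj by (simp add: doubleton_mem_sun_edges insert_commute)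
    next
      case 3
      then show ?thesis using Wadj by (simp add: doubleton_mem_sun_edges)
    next
      case 4
      then show ?thesis using WW by (simp add: doubleton_mem_sun_edges)
    qed
  qed
  then show ?thesis by (simp add: n_def)
qed

theorem strongly_chordal_no_special_cycle:
  assumes simple: "simple_graph V E" and "finite V" and sc: "strongly_chordal V E"
  shows "\<not> special_cycle (max_cliques V E) m x K L"
proof
  let ?P = "\<lambda>m. \<exists>x K L. special_cycle (max_cliques V E) m x K L"
  assume "special_cycle (max_cliques V E) m x K L"
  then have ex: "?P m" by blast
  define l where "l = (LEAST m. ?P m)"
  have "?P l" unfolding l_def by (rule LeastI[of ?P, OF ex])
  then obtain x K L where spec: "special_cycle (max_cliques V E) l x K L" by blast
  have least: "l \<le> m'" if "special_cycle (max_cliques V E) m' x' K' L'" for m' x' K' L'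
    unfolding l_def using that by (intro Least_le) blast
  have chordal: "chordal V E" using sc by (simp add: strongly_chordal_def)
  have "contains_induced V E (sun_verts (Suc l)) (sun_edges (Suc l))"
    using shortest_special_cycle_clique[OF simple \<open>finite V\<close> chordal spec least]
    by (intro special_cycle_clique_sun[OF simple chordal spec])
  moreover have "3 \<le> Suc l" using spec by (simp add: special_cycle_def)
  ultimately show False using sc by (auto simp: strongly_chordal_def)
qed

lemma trace_edges_max_cliques:
  assumes simple: "simple_graph V E" and "finite V"
  shows "trace_edges (max_cliques V E) V = E"
proof
  show "trace_edges (max_cliques V E) V \<subseteq> E"
    unfolding trace_edges_def using max_cliquesD(2) by fast
  show "E \<subseteq> trace_edges (max_cliques V E) V"
  proof
    fix e assume e: "e \<in> E"
    then obtain u v where uv: "u \<in> V" "v \<in> V" "u \<noteq> v" "e = {u, v}"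
      using simple unfolding simple_graph_def by blast
    then have "{u, v} \<in> E" "{v, u} \<in> E" using e by (simp_all add: insert_commute)
    then obtain Q where "Q \<in> max_cliques V E" "{u, v} \<subseteq> Q"
      using clique_subset_max_clique[OF \<open>finite V\<close>, of "{u, v}" E] uv by auto
    then show "e \<in> trace_edges (max_cliques V E) V"
      using uv by (auto simp: doubleton_mem_trace_edges)
  qed
qed

theorem theorem5p11:
  fixes V :: "'a set" and E :: "'a set set"
  assumes "simple_graph V E"
    and "finite V"
    and "strongly_chordal V E"
  shows "\<exists>lab. MAT_labeling V E lab"
proof -
  have "max_cliques V E \<subseteq> Pow V" by (auto simp: max_cliques_def)
  then have fin: "finite (max_cliques V E)" using \<open>finite V\<close> finite_subset by blast
  obtain vs where "distinct vs" "set vs = V" "nest_order (max_cliques V E) vs"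
    using no_special_cycle_nest_order[OF \<open>finite V\<close> fin strongly_chordal_no_special_cycle[OF assms]]
    by blast
  then show ?thesis
    using nest_order_MAT_labeling[OF fin, of vs] trace_edges_max_cliques[OF assms(1,2)] by auto
qed

end
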